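(* Let $U\subset M$ be an open set of a differentiable manifold $M$. Then $c_k(U)\le c_k(M)$ for all $k\ge 0$.
   Context: Differentiable manifolds are smooth manifolds. For such $M$, let $\Omega^k(M)$ be the space of real-valued smooth differential $k$-forms (with $\Omega^{-1}(M)=0$), $d$ the exterior derivative, $Z^k(M)=\ker(d:\Omega^k(M)\to\Omega^{k+1}(M))$ and $B^k(M)=d(\Omega^{k-1}(M))$. Let $\overline{Z}^{k}(M)$ be the space of closed $k$-forms that are exact outside a compact set: $$\overline{Z}^{k}(M)=\{\lambda\in Z^k(M) : \text{there exist a compact } K\subseteq M \text{ and } \nu\in\Omega^{k-1}(M\setminus K) \text{ with } d\nu=\lambda|_{M\setminus K}\}.$$ Then $B^k(M)\subseteq\overline{Z}^{k}(M)$; put $\overline{H}^{k}(M)=\overline{Z}^{k}(M)/B^k(M)$ and $c_k(M)=\dim_{\mathbb{R}}\overline{H}^{k}(M)$ (possibly infinite). *)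

theory Defs
  imports
    "HOL-Analysis.Analysis"
    "HOL-Library.Function_Algebras"
    "HOL-Library.Set_Algebras"
begin

section \<open>Pointwise real vector space structure on functions\<close>

instantiation "fun" :: (type, real_vector) real_vector
begin

definition scaleR_fun :: "real \<Rightarrow> ('a \<Rightarrow> 'b) \<Rightarrow> 'a \<Rightarrow> 'b"
  where "scaleR_fun c f = (\<lambda>x. c *\<^sub>R f x)"

instance
  by standard (simp_all add: scaleR_fun_def fun_eq_iff scaleR_add_right scaleR_add_left)

end

section \<open>Quotient spaces and their dimension\<close>

definition quotient_space :: "'v::real_vector set \<Rightarrow> 'v set \<Rightarrow> 'v set set"
  where "quotient_space Z B = (\<lambda>z. z +o B) ` Z"

text \<open>
  A linear combination of cosets modulo \<open>B\<close>. Setwise, \<open>c *\<^sub>R (z + B)\<close> is \<open>{0}\<close> rather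
  than \<open>B\<close> when \<open>c = 0\<close>; the summand \<open>B\<close> makes the result a coset again in every case.
\<close>

definition coset_lincomb ::
    "'v::real_vector set \<Rightarrow> ('v set \<Rightarrow> real) \<Rightarrow> 'v set set \<Rightarrow> 'v set"
  where "coset_lincomb B a S = (\<Sum>X\<in>S. (\<lambda>x. a X *\<^sub>R x) ` X) + B"

text \<open>The zero vector of the quotient is the coset \<open>B\<close>.\<close>

definition coset_independent :: "'v::real_vector set \<Rightarrow> 'v set set \<Rightarrow> bool"
  where "coset_independent B S \<longleftrightarrow>
    finite S \<and> (\<forall>a. coset_lincomb B a S = B \<longrightarrow> (\<forall>X\<in>S. a X = 0))"

text \<open>
  Dimension of the quotient of \<open>Z\<close> by \<open>B\<close> in \<open>\<nat> \<union> {\<infinity>}\<close>: the supremum of the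
  cardinalities of finite linearly independent sets. (The library's \<open>dim\<close> is a natural number
  and returns \<open>0\<close> for infinite-dimensional spaces.)
\<close>

definition quotient_dim :: "'v::real_vector set \<Rightarrow> 'v set \<Rightarrow> enat"
  where "quotient_dim Z B =
    (SUP S \<in> {S. S \<subseteq> quotient_space Z B \<and> coset_independent B S}. enat (card S))"

section \<open>Smooth maps between finite-dimensional spaces\<close>

text \<open>
  Model spaces are of sort \<open>{real_inner, heine_borel}\<close>: by the theorem of Riesz these
  are exactly the finite-dimensional real inner product spaces. In contrast to
  \<open>euclidean_space\<close>, whose bases are nonempty by definition, dimension \<open>0\<close> is included.
\<close>

text \<open>The zero-dimensional model space.\<close>

instantiation unit :: real_inner
begin

definition zero_unit :: unit where "zero_unit = ()"
definition plus_unit :: "unit \<Rightarrow> unit \<Rightarrow> unit" where "plus_unit x y = ()"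
definition minus_unit :: "unit \<Rightarrow> unit \<Rightarrow> unit" where "minus_unit x y = ()"
definition uminus_unit :: "unit \<Rightarrow> unit" where "uminus_unit x = ()"
definition scaleR_unit :: "real \<Rightarrow> unit \<Rightarrow> unit" where "scaleR_unit c x = ()"
definition inner_unit :: "unit \<Rightarrow> unit \<Rightarrow> real" where "inner_unit x y = 0"
definition norm_unit :: "unit \<Rightarrow> real" where "norm_unit x = 0"
definition dist_unit :: "unit \<Rightarrow> unit \<Rightarrow> real" where "dist_unit x y = 0"
definition sgn_unit :: "unit \<Rightarrow> unit" where "sgn_unit x = ()"
definition uniformity_unit :: "(unit \<times> unit) filter"
  where "uniformity_unit = (INF e\<in>{0<..}. principal {(x, y). dist x y < e})"
definition open_unit :: "unit set \<Rightarrow> bool"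
  where "open_unit U \<longleftrightarrow> (\<forall>x\<in>U. eventually (\<lambda>(x', y). x' = x \<longrightarrow> y \<in> U) uniformity)"

instance
  by standard
    (simp_all add: inner_unit_def norm_unit_def dist_unit_def uniformity_unit_def open_unit_def)

end

instance unit :: heine_borel
proof
  fix f :: "nat \<Rightarrow> unit"
  have "strict_mono (id :: nat \<Rightarrow> nat)" "((f \<circ> id) \<longlongrightarrow> ()) sequentially"
    by (auto simp: strict_mono_def tendsto_def)
  then show "\<exists>l r. strict_mono (r :: nat \<Rightarrow> nat) \<and> ((f \<circ> r) \<longlongrightarrow> l) sequentially"
    by blast
qed

primrec C_k_on :: "nat \<Rightarrow> 'e::real_normed_vector set \<Rightarrow> ('e \<Rightarrow> 'b::real_normed_vector) \<Rightarrow> bool"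
  where
    "C_k_on 0 S f \<longleftrightarrow> continuous_on S f"
  | "C_k_on (Suc n) S f \<longleftrightarrow>
      (\<forall>x\<in>S. f differentiable (at x)) \<and>
      (\<forall>v. C_k_on n S (\<lambda>x. frechet_derivative f (at x) v))"

text \<open>Only meant for open \<open>S\<close>.\<close>

definition smooth_on :: "'e::real_normed_vector set \<Rightarrow> ('e \<Rightarrow> 'b::real_normed_vector) \<Rightarrow> bool"
  where "smooth_on S f \<longleftrightarrow> (\<forall>n. C_k_on n S f)"

section \<open>Smooth manifolds\<close>

text \<open>
  A manifold is given by a topological space and an atlas, indexed by a set \<open>idx\<close>, with chart
  domains \<open>cdom\<close> and coordinate maps \<open>chart\<close>. Indexing the atlas (instead of taking a set of
  charts) lets an open submanifold share the indices of the ambient manifold, so that its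
  tangent spaces below are literally those of the ambient manifold.
\<close>

record ('i, 'a, 'e) manifold =
  mtop :: "'a topology"
  idx :: "'i set"
  cdom :: "'i \<Rightarrow> 'a set"
  chart :: "'i \<Rightarrow> 'a \<Rightarrow> 'e"

definition chart_inv :: "('i, 'a, 'e) manifold \<Rightarrow> 'i \<Rightarrow> 'e \<Rightarrow> 'a"
  where "chart_inv M i = inv_into (cdom M i) (chart M i)"

definition transition :: "('i, 'a, 'e) manifold \<Rightarrow> 'i \<Rightarrow> 'i \<Rightarrow> 'e \<Rightarrow> 'e"
  where "transition M i j = chart M j \<circ> chart_inv M i"

definition charts_at :: "('i, 'a, 'e) manifold \<Rightarrow> 'a \<Rightarrow> 'i set"
  where "charts_at M p = {i \<in> idx M. p \<in> cdom M i}"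

definition second_countable_space :: "'a topology \<Rightarrow> bool"
  where "second_countable_space X \<longleftrightarrow>
    (\<exists>\<B>. countable \<B> \<and> (\<forall>V\<in>\<B>. openin X V) \<and>
      (\<forall>W. openin X W \<longrightarrow> (\<exists>\<C>\<subseteq>\<B>. W = \<Union>\<C>)))"

definition smooth_manifold :: "('i, 'a, 'e::{real_inner,heine_borel}) manifold \<Rightarrow> bool"
  where "smooth_manifold M \<longleftrightarrow>
    Hausdorff_space (mtop M) \<and>
    second_countable_space (mtop M) \<and>
    (\<Union>i\<in>idx M. cdom M i) = topspace (mtop M) \<and>
    (\<forall>i\<in>idx M.
      openin (mtop M) (cdom M i) \<and>
      open (chart M i ` cdom M i) \<and>
      homeomorphic_map (subtopology (mtop M) (cdom M i))
        (top_of_set (chart M i ` cdom M i)) (chart M i)) \<and>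
    (\<forall>i\<in>idx M. \<forall>j\<in>idx M.
      smooth_on (chart M i ` (cdom M i \<inter> cdom M j)) (transition M i j))"

definition open_submanifold :: "('i, 'a, 'e) manifold \<Rightarrow> 'a set \<Rightarrow> ('i, 'a, 'e) manifold"
  where "open_submanifold M U =
    \<lparr>mtop = subtopology (mtop M) U, idx = idx M,
     cdom = (\<lambda>i. cdom M i \<inter> U), chart = chart M\<rparr>"

text \<open>
  A tangent vector at \<open>p\<close> is a family of coordinate vectors, one for each chart at \<open>p\<close>, that
  transform by the derivatives of the transition maps. Indices that are not charts at \<open>p\<close>
  carry the value \<open>0\<close>, so that each tangent vector is represented by exactly one function.
\<close>

definition tangent_space ::
    "('i, 'a, 'e::{real_inner,heine_borel}) manifold \<Rightarrow> 'a \<Rightarrow> ('i \<Rightarrow> 'e) set"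
  where "tangent_space M p =
    {v. (\<forall>i. i \<notin> charts_at M p \<longrightarrow> v i = 0) \<and>
        (\<forall>i\<in>charts_at M p. \<forall>j\<in>charts_at M p.
          v j = frechet_derivative (transition M i j) (at (chart M i p)) (v i))}"

text \<open>The tangent vector at \<open>p\<close> with coordinate vector \<open>w\<close> in chart \<open>i\<close>.\<close>

definition tangent_of ::
    "('i, 'a, 'e::{real_inner,heine_borel}) manifold \<Rightarrow> 'i \<Rightarrow> 'a \<Rightarrow> 'e \<Rightarrow> ('i \<Rightarrow> 'e)"
  where "tangent_of M i p w =
    (\<lambda>j. if j \<in> charts_at M p
      then frechet_derivative (transition M i j) (at (chart M i p)) w else 0)"

section \<open>Differential forms\<close>

text \<open>
  Alternating \<open>k\<close>-linear forms on a subspace \<open>V\<close>, as functions on lists of length \<open>k\<close>. The value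
  \<open>0\<close> is prescribed off \<open>V\<^sup>k\<close> so that equality of forms is equality of functions.
\<close>

definition alternating_forms :: "nat \<Rightarrow> 'v::real_vector set \<Rightarrow> ('v list \<Rightarrow> real) set"
  where "alternating_forms k V =
    {f. (\<forall>vs. \<not> (length vs = k \<and> set vs \<subseteq> V) \<longrightarrow> f vs = 0) \<and>
        (\<forall>vs j x y. length vs = k \<and> set vs \<subseteq> V \<and> j < k \<and> x \<in> V \<and> y \<in> V \<longrightarrow>
          f (vs[j := x + y]) = f (vs[j := x]) + f (vs[j := y])) \<and>
        (\<forall>vs j c x. length vs = k \<and> set vs \<subseteq> V \<and> j < k \<and> x \<in> V \<longrightarrow>
          f (vs[j := c *\<^sub>R x]) = c * f (vs[j := x])) \<and>
        (\<forall>vs i j. length vs = k \<and> set vs \<subseteq> V \<and> i < j \<and> j < k \<and> vs ! i = vs ! j \<longrightarrow>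
          f vs = 0)}"

type_synonym ('i, 'a, 'e) form = "'a \<Rightarrow> ('i \<Rightarrow> 'e) list \<Rightarrow> real"

text \<open>The coordinate expression of a form in chart \<open>i\<close>, a form on the image of the chart.\<close>

definition local_rep ::
    "('i, 'a, 'e::{real_inner,heine_borel}) manifold \<Rightarrow> ('i, 'a, 'e) form \<Rightarrow> 'i \<Rightarrow>
      'e \<Rightarrow> 'e list \<Rightarrow> real"
  where "local_rep M \<omega> i x ws =
    \<omega> (chart_inv M i x) (map (tangent_of M i (chart_inv M i x)) ws)"

definition forms ::
    "nat \<Rightarrow> ('i, 'a, 'e::{real_inner,heine_borel}) manifold \<Rightarrow> ('i, 'a, 'e) form set"
  where "forms k M =
    {\<omega>. (\<forall>p\<in>topspace (mtop M). \<omega> p \<in> alternating_forms k (tangent_space M p)) \<and>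
        (\<forall>p. p \<notin> topspace (mtop M) \<longrightarrow> \<omega> p = 0) \<and>
        (\<forall>i\<in>idx M. \<forall>ws. length ws = k \<longrightarrow>
          smooth_on (chart M i ` cdom M i) (\<lambda>x. local_rep M \<omega> i x ws))}"

text \<open>
  On an open subset of a vector space, for constant vector fields \<open>w\<^sub>0, \<dots>, w\<^sub>k\<close>,
  \<open>d\<eta> (w\<^sub>0, \<dots>, w\<^sub>k) = \<Sum>j. (-1)^j D\<^bsub>w\<^sub>j\<^esub> (\<eta> (w\<^sub>0, \<dots>, w\<^sub>k without w\<^sub>j))\<close>.
\<close>

definition local_ext_deriv ::
    "('e::real_normed_vector \<Rightarrow> 'e list \<Rightarrow> real) \<Rightarrow> 'e \<Rightarrow> 'e list \<Rightarrow> real"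
  where "local_ext_deriv \<eta> x ws =
    (\<Sum>j<length ws. (-1) ^ j *
      frechet_derivative (\<lambda>y. \<eta> y (take j ws @ drop (Suc j) ws)) (at x) (ws ! j))"

text \<open>
  The exterior derivative at \<open>p\<close> is computed in some chart at \<open>p\<close>; for smooth forms the
  result is the same for each of them.
\<close>

definition ext_deriv ::
    "('i, 'a, 'e::{real_inner,heine_borel}) manifold \<Rightarrow> ('i, 'a, 'e) form \<Rightarrow> ('i, 'a, 'e) form"
  where "ext_deriv M \<omega> = (\<lambda>p vs.
    if p \<in> topspace (mtop M) \<and> set vs \<subseteq> tangent_space M p
    then let i = (SOME i. i \<in> charts_at M p)
      in local_ext_deriv (local_rep M \<omega> i) (chart M i p) (map (\<lambda>v. v i) vs)
    else 0)"

section \<open>Cohomology of forms that are exact outside a compact set\<close>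

text \<open>\<open>forms_pred k M\<close> is the space of forms of degree \<open>k - 1\<close>, which is zero for \<open>k = 0\<close>.\<close>

definition forms_pred ::
    "nat \<Rightarrow> ('i, 'a, 'e::{real_inner,heine_borel}) manifold \<Rightarrow> ('i, 'a, 'e) form set"
  where "forms_pred k M = (case k of 0 \<Rightarrow> {0} | Suc m \<Rightarrow> forms m M)"

definition closed_forms ::
    "nat \<Rightarrow> ('i, 'a, 'e::{real_inner,heine_borel}) manifold \<Rightarrow> ('i, 'a, 'e) form set"
  where "closed_forms k M = {\<omega> \<in> forms k M. ext_deriv M \<omega> = 0}"

definition exact_forms ::
    "nat \<Rightarrow> ('i, 'a, 'e::{real_inner,heine_borel}) manifold \<Rightarrow> ('i, 'a, 'e) form set"
  where "exact_forms k M = ext_deriv M ` forms_pred k M"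

definition restrict_form :: "('i, 'a, 'e) form \<Rightarrow> 'a set \<Rightarrow> ('i, 'a, 'e) form"
  where "restrict_form \<omega> U = (\<lambda>p. if p \<in> U then \<omega> p else 0)"

definition closed_forms_exact_at_infinity ::
    "nat \<Rightarrow> ('i, 'a, 'e::{real_inner,heine_borel}) manifold \<Rightarrow> ('i, 'a, 'e) form set"
  where "closed_forms_exact_at_infinity k M =
    {\<omega> \<in> closed_forms k M. \<exists>K. compactin (mtop M) K \<and>
      (let N = open_submanifold M (topspace (mtop M) - K)
       in \<exists>\<nu> \<in> forms_pred k N. ext_deriv N \<nu> = restrict_form \<omega> (topspace (mtop N)))}"

definition c_number :: "nat \<Rightarrow> ('i, 'a, 'e::{real_inner,heine_borel}) manifold \<Rightarrow> enat"
  where "c_number k M = quotient_dim (closed_forms_exact_at_infinity k M) (exact_forms k M)"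

end

theory Submission
  imports Defs
begin

text \<open>
  Let \<open>\<alpha>\<close> be a closed form on \<open>U\<close> with \<open>\<alpha> = d\<nu>\<close> outside a compact set \<open>K\<close>, and let \<open>\<phi>\<close> be a smooth
  function with compact support in \<open>U\<close> and \<open>\<phi> = 1\<close> near \<open>K\<close>. Then \<open>\<omega> = \<alpha> - d((1 - \<phi>)\<nu>)\<close> is cohomologous
  to \<open>\<alpha>\<close> on \<open>U\<close> and, being compactly supported, extends by zero to a closed form on \<open>M\<close>
  that is exact at infinity. So every class on \<open>U\<close> is the restriction of the class of such an
  extension; as restriction maps exact forms on \<open>M\<close> to exact forms on \<open>U\<close>, the extensions of
  linearly independent classes are linearly independent.

  The exterior derivative is defined by choosing a chart at each point, and its independence
  of that choice is never needed in general: outside \<open>K\<close> one has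
  \<open>\<omega> = d(\<phi>\<nu>) = \<phi> d\<nu> + d\<phi> \<and> \<nu>\<close>, where \<open>d\<nu> = \<alpha>\<close> is known to be a smooth form, so that only
  the chain rule for \<open>d\<phi>\<close> is used.
\<close>

section \<open>Smooth functions\<close>

text \<open>As \<open>ext_deriv\<close> selects a chart separately at each point, neither smoothness
  of \<open>d\<mu>\<close> for smooth \<open>\<mu>\<close> nor \<open>d d = 0\<close> is at hand. On
  \<open>U - K\<close>, closedness of \<open>d(\<phi>\<nu>)\<close> therefore comes from an explicit
  cancellation of two terms \<open>d\<phi> \<and> d\<nu>\<close> of opposite sign, which rests on
  \<open>d d\<nu> = d\<alpha> = 0\<close> and on the symmetry of the second derivatives of
  \<open>\<phi>\<close>. Near \<open>K\<close>, where \<open>\<phi> = 1\<close>, the form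
  \<open>\<omega>\<close> is \<open>\<alpha>\<close> itself; these two open sets cover
  \<open>U\<close>, and being a closed form is a local property. Extending by zero leaves the
  function unchanged: a form is already zero off its manifold, and tangent spaces of an open
  submanifold are those of the ambient one, so \<open>\<omega>\<close> is literally the same object
  on \<open>U\<close> and on \<open>M\<close>. The dimension is a supremum over finite independent
  sets, hence lifting one finite set at a time also settles the infinite-dimensional case; the
  extensions are chosen arbitrarily, and only restriction has to be linear. In degree 0 there is no
  \<open>\<nu>\<close> to cut off, and \<open>\<alpha>\<close> already vanishes outside
  \<open>K\<close>.\<close>

lemma frechet_derivative_cong_open:
  assumes "open S" "x \<in> S" "\<And>y. y \<in> S \<Longrightarrow> f y = g y"
  shows "frechet_derivative f (at x) = frechet_derivative g (at x)"
proof -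
  have "(f has_derivative D) (at x) \<longleftrightarrow> (g has_derivative D) (at x)" for D
    using assms has_derivative_transform_within_open[of _ D x UNIV S] by metis
  then show ?thesis by (simp add: frechet_derivative_def)
qed

lemma differentiable_cong_open:
  assumes "open S" "x \<in> S" "\<And>y. y \<in> S \<Longrightarrow> f y = g y"
  shows "f differentiable (at x) \<longleftrightarrow> g differentiable (at x)"
  using assms has_derivative_transform_within_open[of _ _ x UNIV S]
  unfolding differentiable_def by metis

lemma C_k_on_cong:
  assumes "open S" "\<And>x. x \<in> S \<Longrightarrow> f x = g x"
  shows "C_k_on n S f \<longleftrightarrow> C_k_on n S g"
  using assms(2)
proof (induction n arbitrary: f g)
  case 0
  then show ?case by (simp cong: continuous_on_cong)
next
  case (Suc n)
  have "C_k_on n S (\<lambda>x. frechet_derivative f (at x) v) \<longleftrightarrow>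
      C_k_on n S (\<lambda>x. frechet_derivative g (at x) v)" for v
    using Suc frechet_derivative_cong_open[OF assms(1) _ Suc.prems] by (intro Suc.IH) simp
  then show ?case
    using differentiable_cong_open[OF assms(1) _ Suc.prems] by simp
qed

lemma C_k_on_subset: "C_k_on n S f \<Longrightarrow> T \<subseteq> S \<Longrightarrow> C_k_on n T f"
  by (induction n arbitrary: f) (auto intro: continuous_on_subset)

lemma C_k_on_Suc_imp: "C_k_on (Suc n) S f \<Longrightarrow> C_k_on n S f"
proof (induction n arbitrary: f)
  case 0
  then show ?case
    by (auto intro!: continuous_at_imp_continuous_on differentiable_imp_continuous_within)
qed auto

lemma C_k_on_local:
  assumes "\<And>x. x \<in> S \<Longrightarrow> \<exists>T. open T \<and> x \<in> T \<and> C_k_on n T f"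
  shows "C_k_on n S f"
  using assms
proof (induction n arbitrary: f)
  case 0
  then show ?case
    by (auto intro!: continuous_at_imp_continuous_on) (metis continuous_on_eq_continuous_at)
next
  case (Suc n)
  have "f differentiable (at x)" if "x \<in> S" for x
    using Suc.prems[OF that] by auto
  moreover have "C_k_on n S (\<lambda>x. frechet_derivative f (at x) v)" for v
    using Suc.prems by (intro Suc.IH) (metis C_k_on.simps(2))
  ultimately show ?case by simp
qed

lemma C_k_on_const: "C_k_on n S (\<lambda>x. c)"
  by (induction n arbitrary: c) auto

lemma frechet_derivative_add:
  assumes "f differentiable (at x)" "g differentiable (at x)"
  shows "frechet_derivative (\<lambda>x. f x + g x) (at x) v =
    frechet_derivative f (at x) v + frechet_derivative g (at x) v"
  using has_derivative_add[OF assms[unfolded frechet_derivative_works]]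
  by (metis frechet_derivative_at)

lemma (in bounded_bilinear) frechet_derivative_prod:
  assumes "f differentiable (at x)" "g differentiable (at x)"
  shows "frechet_derivative (\<lambda>x. prod (f x) (g x)) (at x) v =
    prod (f x) (frechet_derivative g (at x) v) + prod (frechet_derivative f (at x) v) (g x)"
  using FDERIV[OF assms[unfolded frechet_derivative_works]]
  by (metis (no_types, lifting) frechet_derivative_at)

lemma (in bounded_bilinear) differentiable_prod:
  assumes "f differentiable (at x)" "g differentiable (at x)"
  shows "(\<lambda>x. prod (f x) (g x)) differentiable (at x)"
  using FDERIV[OF assms[unfolded frechet_derivative_works]] by (rule differentiableI)

lemma C_k_on_add:
  assumes "open S" "C_k_on n S f" "C_k_on n S g"
  shows "C_k_on n S (\<lambda>x. f x + g x)"
  using assms(2,3)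
proof (induction n arbitrary: f g)
  case (Suc n)
  have "C_k_on n S (\<lambda>x. frechet_derivative (\<lambda>x. f x + g x) (at x) v)" for v
    using Suc.prems Suc.IH
    by (subst C_k_on_cong[OF assms(1) frechet_derivative_add]) auto
  then show ?case using Suc.prems by auto
qed (auto intro: continuous_on_add)

lemma (in bounded_bilinear) C_k_on_prod:
  assumes "open S" "C_k_on n S f" "C_k_on n S g"
  shows "C_k_on n S (\<lambda>x. prod (f x) (g x))"
  using assms(2,3)
proof (induction n arbitrary: f g)
  case 0
  then show ?case by (auto intro: continuous_on)
next
  case (Suc n)
  have "C_k_on n S (\<lambda>x. frechet_derivative (\<lambda>x. prod (f x) (g x)) (at x) v)" for v
    using Suc.prems Suc.IH Suc.prems[THEN C_k_on_Suc_imp]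
    by (subst C_k_on_cong[OF assms(1) frechet_derivative_prod]) (auto intro!: C_k_on_add assms(1))
  then show ?case using Suc.prems by (simp add: differentiable_prod)
qed

text \<open>For a function \<open>f\<close> of one real variable, linearity turns
  \<open>Df(g x)(Dg(x) v)\<close> into the scalar \<open>Dg(x) v\<close> times
  \<open>f'(g x)\<close>, a product whose second factor is covered by the induction hypothesis.
  Cut-offs only ever compose with functions of one variable.\<close>

lemma C_k_on_compose_real:
  fixes f :: "real \<Rightarrow> 'b::real_normed_vector"
  assumes "open S" "C_k_on n S g" "C_k_on n T f" "g ` S \<subseteq> T"
  shows "C_k_on n S (\<lambda>x. f (g x))"
  using assms(2,3)
proof (induction n arbitrary: f)
  case 0
  then show ?case using assms(4) by (auto intro: continuous_on_compose2)
next
  case (Suc n)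
  have diff: "(\<lambda>x. f (g x)) differentiable (at x)"
    and deriv: "frechet_derivative (\<lambda>x. f (g x)) (at x) v =
      frechet_derivative g (at x) v *\<^sub>R frechet_derivative f (at (g x)) 1" if "x \<in> S" for x v
  proof -
    have f: "f differentiable (at (g x))" and g: "g differentiable (at x)"
      using Suc.prems assms(4) that by auto
    show "(\<lambda>x. f (g x)) differentiable (at x)"
      using differentiable_chain_at[OF g f] by (simp add: o_def)
    have "frechet_derivative (\<lambda>x. f (g x)) (at x) v =
        frechet_derivative f (at (g x)) (frechet_derivative g (at x) v *\<^sub>R 1)"
      using frechet_derivative_compose[OF g f] by (simp add: o_def)
    then show "frechet_derivative (\<lambda>x. f (g x)) (at x) v =
        frechet_derivative g (at x) v *\<^sub>R frechet_derivative f (at (g x)) 1"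
      using linear_frechet_derivative[OF f] by (simp only: linear_scale)
  qed
  have "C_k_on n S g"
    using Suc.prems(1) by (rule C_k_on_Suc_imp)
  have "C_k_on n S (\<lambda>x. frechet_derivative g (at x) v *\<^sub>R frechet_derivative f (at (g x)) 1)" for v
    by (rule bounded_bilinear.C_k_on_prod[OF bounded_bilinear_scaleR assms(1)])
      (use Suc.prems Suc.IH[OF \<open>C_k_on n S g\<close>, of "\<lambda>y. frechet_derivative f (at y) 1"] in auto)
  then have "C_k_on n S (\<lambda>x. frechet_derivative (\<lambda>x. f (g x)) (at x) v)" for v
    using C_k_on_cong[OF assms(1) deriv[of _ v], where n = n] by simp
  then show ?case using diff by simp
qed

section \<open>Sums, products and derivatives of smooth functions\<close>

lemma smooth_on_cong:
  "open S \<Longrightarrow> (\<And>x. x \<in> S \<Longrightarrow> f x = g x) \<Longrightarrow> smooth_on S f \<longleftrightarrow> smooth_on S g"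
  unfolding smooth_on_def using C_k_on_cong by blast

lemma smooth_on_subset: "smooth_on S f \<Longrightarrow> T \<subseteq> S \<Longrightarrow> smooth_on T f"
  unfolding smooth_on_def using C_k_on_subset by blast

lemma smooth_on_local:
  "(\<And>x. x \<in> S \<Longrightarrow> \<exists>T. open T \<and> x \<in> T \<and> smooth_on T f) \<Longrightarrow> smooth_on S f"
  unfolding smooth_on_def by (intro allI C_k_on_local) meson

lemma smooth_on_const: "smooth_on S (\<lambda>x. c)"
  by (simp add: smooth_on_def C_k_on_const)

lemma smooth_on_add:
  "open S \<Longrightarrow> smooth_on S f \<Longrightarrow> smooth_on S g \<Longrightarrow> smooth_on S (\<lambda>x. f x + g x)"
  by (simp add: smooth_on_def C_k_on_add)

lemma smooth_on_mult:
  fixes f g :: "'e::real_normed_vector \<Rightarrow> real"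
  shows "open S \<Longrightarrow> smooth_on S f \<Longrightarrow> smooth_on S g \<Longrightarrow> smooth_on S (\<lambda>x. f x * g x)"
  by (simp add: smooth_on_def bounded_bilinear.C_k_on_prod[OF bounded_bilinear_mult])

lemma smooth_on_inner:
  "open S \<Longrightarrow> smooth_on S f \<Longrightarrow> smooth_on S g \<Longrightarrow> smooth_on S (\<lambda>x. inner (f x) (g x))"
  by (simp add: smooth_on_def bounded_bilinear.C_k_on_prod[OF bounded_bilinear_inner])

lemma smooth_on_diff:
  assumes "open S" "smooth_on S f" "smooth_on S g"
  shows "smooth_on S (\<lambda>x. f x - g x)"
proof -
  have "smooth_on S (\<lambda>x. (- 1) *\<^sub>R g x)"
    unfolding smooth_on_def
    by (intro allI bounded_bilinear.C_k_on_prod[OF bounded_bilinear_scaleR] assms C_k_on_const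
        assms(3)[unfolded smooth_on_def, rule_format])
  with smooth_on_add[OF assms(1,2)] show ?thesis by fastforce
qed

lemma smooth_on_sum:
  "open S \<Longrightarrow> (\<And>i. i \<in> I \<Longrightarrow> smooth_on S (f i)) \<Longrightarrow> smooth_on S (\<lambda>x. \<Sum>i\<in>I. f i x)"
  by (induction I rule: infinite_finite_induct) (simp_all add: smooth_on_const smooth_on_add)

lemma smooth_on_compose_real:
  fixes f :: "real \<Rightarrow> 'b::real_normed_vector"
  shows "open S \<Longrightarrow> smooth_on S g \<Longrightarrow> smooth_on T f \<Longrightarrow> g ` S \<subseteq> T \<Longrightarrow> smooth_on S (\<lambda>x. f (g x))"
  unfolding smooth_on_def using C_k_on_compose_real by blast

lemma smooth_on_imp_differentiable: "smooth_on S f \<Longrightarrow> x \<in> S \<Longrightarrow> f differentiable (at x)"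
  unfolding smooth_on_def by (metis C_k_on.simps(2))

lemma smooth_on_frechet_derivative:
  "smooth_on S f \<Longrightarrow> smooth_on S (\<lambda>x. frechet_derivative f (at x) v)"
  unfolding smooth_on_def by (metis C_k_on.simps(2))

lemma smooth_on_imp_continuous_on: "smooth_on S f \<Longrightarrow> continuous_on S f"
  unfolding smooth_on_def by (metis C_k_on.simps(1))

lemma frechet_derivative_mult:
  fixes f g :: "'e::real_normed_vector \<Rightarrow> real"
  assumes "f differentiable (at x)" "g differentiable (at x)"
  shows "frechet_derivative (\<lambda>x. f x * g x) (at x) v =
    f x * frechet_derivative g (at x) v + frechet_derivative f (at x) v * g x"
  by (rule bounded_bilinear.frechet_derivative_prod[OF bounded_bilinear_mult assms])

lemma frechet_derivative_sum:
  assumes "\<And>i. i \<in> I \<Longrightarrow> f i differentiable (at x)"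
  shows "frechet_derivative (\<lambda>x. \<Sum>i\<in>I. f i x) (at x) v =
    (\<Sum>i\<in>I. frechet_derivative (f i) (at x) v)"
proof -
  have "((\<lambda>x. \<Sum>i\<in>I. f i x) has_derivative (\<lambda>v. \<Sum>i\<in>I. frechet_derivative (f i) (at x) v)) (at x)"
    using assms by (intro has_derivative_sum) (simp add: frechet_derivative_works)
  then show ?thesis by (metis frechet_derivative_at)
qed

lemma frechet_derivative_chain:
  assumes "g differentiable (at x)" "f differentiable (at (g x))"
  shows "frechet_derivative (\<lambda>x. f (g x)) (at x) v =
    frechet_derivative f (at (g x)) (frechet_derivative g (at x) v)"
  using frechet_derivative_compose[OF assms] by (simp add: o_def)

subsection \<open>Symmetry of second derivatives\<close>

lemma has_real_derivative_along_line:
  fixes f :: "'e::real_normed_vector \<Rightarrow> real"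
  assumes "f differentiable (at (y + s *\<^sub>R v))"
  shows "((\<lambda>s. f (y + s *\<^sub>R v)) has_real_derivative frechet_derivative f (at (y + s *\<^sub>R v)) v) (at s)"
proof -
  let ?D = "frechet_derivative f (at (y + s *\<^sub>R v))"
  have g: "((\<lambda>s. y + s *\<^sub>R v) has_derivative (\<lambda>h. h *\<^sub>R v)) (at s)"
    by (auto intro!: derivative_eq_intros)
  have "(f has_derivative ?D) (at (y + s *\<^sub>R v))"
    using assms frechet_derivative_works by blast
  from diff_chain_at[OF g this]
  have "((\<lambda>s. f (y + s *\<^sub>R v)) has_derivative (\<lambda>h. ?D (h *\<^sub>R v))) (at s)"
    by (simp add: o_def)
  moreover have "?D (h *\<^sub>R v) = ?D v * h" for h
    using linear_frechet_derivative[OF assms] by (simp add: linear_scale)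
  ultimately show ?thesis by (simp add: has_field_derivative_def)
qed

text \<open>The mean value theorem is used twice: in direction \<open>v\<close> for the difference
  \<open>u\<close> of \<open>f\<close> over the step \<open>h w\<close>, then in direction
  \<open>w\<close> for the derivative of \<open>f\<close> along \<open>v\<close>.\<close>

lemma second_difference_mean_value:
  fixes f :: "'e::real_normed_vector \<Rightarrow> real"
  assumes "smooth_on S f" "h > 0"
    and S: "\<And>s t. 0 \<le> s \<Longrightarrow> s \<le> h \<Longrightarrow> 0 \<le> t \<Longrightarrow> t \<le> h \<Longrightarrow> x + s *\<^sub>R v + t *\<^sub>R w \<in> S"
  obtains s t where "0 < s" "s < h" "0 < t" "t < h"
    "f (x + h *\<^sub>R v + h *\<^sub>R w) - f (x + h *\<^sub>R v) - f (x + h *\<^sub>R w) + f x =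
      h * h * frechet_derivative (\<lambda>y. frechet_derivative f (at y) v) (at (x + s *\<^sub>R v + t *\<^sub>R w)) w"
proof -
  let ?D = "\<lambda>y. frechet_derivative f (at y) v"
  have S0: "x + s *\<^sub>R v \<in> S" if "0 \<le> s" "s \<le> h" for s
    using S[of s 0] that assms(2) by simp
  define u where "u s = f (x + h *\<^sub>R w + s *\<^sub>R v) - f (x + s *\<^sub>R v)" for s
  have "(u has_real_derivative ?D (x + h *\<^sub>R w + s *\<^sub>R v) - ?D (x + s *\<^sub>R v)) (at s)"
    if "0 \<le> s" "s \<le> h" for s
    unfolding u_def using that S[of s h] S0 assms(1,2)
    by (intro DERIV_diff has_real_derivative_along_line smooth_on_imp_differentiable[of S])
      (auto simp: algebra_simps)
  then obtain s where s: "0 < s" "s < h"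
    "u h - u 0 = h * (?D (x + h *\<^sub>R w + s *\<^sub>R v) - ?D (x + s *\<^sub>R v))"
    using MVT2[of 0 h u "\<lambda>s. ?D (x + h *\<^sub>R w + s *\<^sub>R v) - ?D (x + s *\<^sub>R v)"] assms(2) by auto
  have "((\<lambda>t. ?D (x + s *\<^sub>R v + t *\<^sub>R w)) has_real_derivative
      frechet_derivative ?D (at (x + s *\<^sub>R v + t *\<^sub>R w)) w) (at t)" if "0 \<le> t" "t \<le> h" for t
    using S[of s t] s that smooth_on_frechet_derivative[OF assms(1)]
    by (intro has_real_derivative_along_line smooth_on_imp_differentiable[of S]) auto
  then obtain t where t: "0 < t" "t < h"
    "?D (x + s *\<^sub>R v + h *\<^sub>R w) - ?D (x + s *\<^sub>R v) =
      h * frechet_derivative ?D (at (x + s *\<^sub>R v + t *\<^sub>R w)) w"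
    using MVT2[of 0 h "\<lambda>t. ?D (x + s *\<^sub>R v + t *\<^sub>R w)"
        "\<lambda>t. frechet_derivative ?D (at (x + s *\<^sub>R v + t *\<^sub>R w)) w"] assms(2) by auto
  have "f (x + h *\<^sub>R v + h *\<^sub>R w) - f (x + h *\<^sub>R v) - f (x + h *\<^sub>R w) + f x = u h - u 0"
    by (simp add: u_def algebra_simps)
  also have "\<dots> = h * h * frechet_derivative ?D (at (x + s *\<^sub>R v + t *\<^sub>R w)) w"
    using s(3) t(3) by (simp add: algebra_simps)
  finally show thesis using that s t by blast
qed

lemma second_difference_quotient_tendsto:
  fixes f :: "'e::real_normed_vector \<Rightarrow> real"
  assumes "open S" "x \<in> S" "smooth_on S f"
  shows "((\<lambda>h. (f (x + h *\<^sub>R v + h *\<^sub>R w) - f (x + h *\<^sub>R v) - f (x + h *\<^sub>R w) + f x) / (h * h)) \<longlongrightarrow>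
    frechet_derivative (\<lambda>y. frechet_derivative f (at y) v) (at x) w) (at_right 0)"
    (is "(?q \<longlongrightarrow> ?D x) _")
proof (rule tendstoI)
  fix e :: real assume "e > 0"
  have "continuous_on S ?D"
    by (intro smooth_on_imp_continuous_on smooth_on_frechet_derivative assms(3))
  then have "isCont ?D x"
    using assms(1,2) continuous_on_eq_continuous_at by blast
  then obtain d where d: "d > 0" "\<And>y. dist y x < d \<Longrightarrow> dist (?D y) (?D x) < e"
    using \<open>e > 0\<close> by (auto simp: continuous_at_eps_delta)
  obtain r where r: "r > 0" "ball x r \<subseteq> S"
    using assms(1,2) openE by blast
  \<comment> \<open>For \<open>h < b\<close> the whole parallelogram spanned by \<open>h v\<close>
    and \<open>h w\<close> at \<open>x\<close> stays within distance \<open>min d r\<close> of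
    \<open>x\<close>; the summand 1 keeps the denominator positive.\<close>
  define b where "b = min d r / (norm v + norm w + 1)"
  have nz: "0 < norm v + norm w + 1"
    by (smt (verit) norm_ge_zero)
  then have "b > 0"
    using d r by (simp add: b_def)
  have small: "dist (x + s *\<^sub>R v + t *\<^sub>R w) x < min d r"
    if "0 \<le> s" "s \<le> h" "0 \<le> t" "t \<le> h" "0 < h" "h < b" for s t h
  proof -
    have "dist (x + s *\<^sub>R v + t *\<^sub>R w) x = norm (s *\<^sub>R v + t *\<^sub>R w)"
      by (simp add: dist_norm algebra_simps)
    also have "\<dots> \<le> s * norm v + t * norm w"
      using norm_triangle_ineq[of "s *\<^sub>R v" "t *\<^sub>R w"] that by simp
    also have "\<dots> \<le> h * norm v + h * norm w"
      using that by (intro add_mono mult_right_mono) auto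
    also have "\<dots> < h * (norm v + norm w + 1)"
      using that by (simp add: algebra_simps)
    also have "\<dots> < b * (norm v + norm w + 1)"
      using that nz by (intro mult_strict_right_mono) auto
    also have "\<dots> = min d r"
      using nz by (simp add: b_def)
    finally show ?thesis .
  qed
  have "dist (?q h) (?D x) < e" if h: "0 < h" "h < b" for h
  proof -
    have "x + s *\<^sub>R v + t *\<^sub>R w \<in> S" if "0 \<le> s" "s \<le> h" "0 \<le> t" "t \<le> h" for s t
    proof -
      have "dist (x + s *\<^sub>R v + t *\<^sub>R w) x < min d r" using small that h by blast
      then show ?thesis using r by (auto simp: dist_commute)
    qed
    from second_difference_mean_value[OF assms(3) h(1) this]
    obtain s t where st: "0 < s" "s < h" "0 < t" "t < h"
      "f (x + h *\<^sub>R v + h *\<^sub>R w) - f (x + h *\<^sub>R v) - f (x + h *\<^sub>R w) + f x =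
        h * h * ?D (x + s *\<^sub>R v + t *\<^sub>R w)" by blast
    then have "?q h = ?D (x + s *\<^sub>R v + t *\<^sub>R w)" using h by simp
    moreover have "dist (x + s *\<^sub>R v + t *\<^sub>R w) x < min d r"
      using st h by (intro small[of s h t]) auto
    ultimately show ?thesis using d(2) by simp
  qed
  then show "\<forall>\<^sub>F h in at_right 0. dist (?q h) (?D x) < e"
    using \<open>b > 0\<close> by (auto simp: eventually_at_right_field)
qed

text \<open>The second difference does not change when \<open>v\<close> and \<open>w\<close> are
  exchanged, so both mixed derivatives are limits of one and the same quotient.\<close>

lemma symmetric_second_derivative:
  fixes f :: "'e::real_normed_vector \<Rightarrow> real"
  assumes "open S" "x \<in> S" "smooth_on S f"
  shows "frechet_derivative (\<lambda>y. frechet_derivative f (at y) v) (at x) w =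
    frechet_derivative (\<lambda>y. frechet_derivative f (at y) w) (at x) v"
proof (rule tendsto_unique)
  show "((\<lambda>h. (f (x + h *\<^sub>R v + h *\<^sub>R w) - f (x + h *\<^sub>R v) - f (x + h *\<^sub>R w) + f x) / (h * h)) \<longlongrightarrow>
    frechet_derivative (\<lambda>y. frechet_derivative f (at y) w) (at x) v) (at_right 0)"
    using second_difference_quotient_tendsto[OF assms, of w v] by (simp add: algebra_simps)
qed (use second_difference_quotient_tendsto[OF assms] in auto)

subsection \<open>A smooth cut-off function on the real line\<close>

lemma C_k_on_real_derivative:
  assumes "\<And>x. x \<in> S \<Longrightarrow> (f has_real_derivative f' x) (at x)" "C_k_on n S f'" "open S"
  shows "C_k_on (Suc n) S f"
proof -
  have D: "frechet_derivative f (at x) v = f' x * v" if "x \<in> S" for x v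
    using assms(1)[OF that] unfolding has_field_derivative_def by (metis frechet_derivative_at)
  have "C_k_on n S (\<lambda>x. f' x * v)" for v
    by (intro bounded_bilinear.C_k_on_prod[OF bounded_bilinear_mult] assms C_k_on_const)
  then have "C_k_on n S (\<lambda>x. frechet_derivative f (at x) v)" for v
    using C_k_on_cong[OF assms(3) D[of _ v], where n = n] by simp
  moreover have "f differentiable (at x)" if "x \<in> S" for x
    using assms(1)[OF that] by (meson differentiable_def has_field_derivative_imp_has_derivative)
  ultimately show ?thesis by simp
qed

text \<open>The factor \<open>t\<^sup>-\<^sup>m\<close> makes the span of these functions closed under differentiation.\<close>

definition flat :: "nat \<Rightarrow> real \<Rightarrow> real"
  where "flat m t = (if t > 0 then inverse t ^ m * exp (- inverse t) else 0)"

lemma flat_has_derivative: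
  "(flat m has_real_derivative (flat (m + 2) t - real m * flat (m + 1) t)) (at t)"
proof -
  consider "t > 0" | "t < 0" | "t = 0" by linarith
  then show ?thesis
  proof cases
    case 1
    have "m - 1 = 0 \<or> t ^ (m - 1) = t * t ^ (m - 1 - 1)"
      using power_minus_mult[of "m - 1" t] by (metis mult.commute neq0_conv)
    then have "((\<lambda>t. inverse t ^ m * exp (- inverse t)) has_real_derivative
        flat (m + 2) t - real m * flat (m + 1) t) (at t)"
      using 1
      by (cases m) (auto intro!: derivative_eq_intros simp: flat_def power2_eq_square field_simps)
    moreover have "\<forall>\<^sub>F s in nhds t. inverse s ^ m * exp (- inverse s) = flat m s"
      by (rule eventually_mono[OF eventually_nhds_in_open[of "{0<..}" t]]) (use 1 in \<open>auto simp: flat_def\<close>)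
    ultimately show ?thesis using DERIV_cong_ev by fast
  next
    case 2
    have "((\<lambda>t. 0) has_real_derivative flat (m + 2) t - real m * flat (m + 1) t) (at t)"
      using 2 by (auto simp: flat_def)
    moreover have "\<forall>\<^sub>F s in nhds t. 0 = flat m s"
      by (rule eventually_mono[OF eventually_nhds_in_open[of "{..<0}" t]]) (use 2 in \<open>auto simp: flat_def\<close>)
    ultimately show ?thesis using DERIV_cong_ev by fast
  next
    case 3
    \<comment> \<open>With \<open>s = 1/h\<close> the difference quotient from the right is
      \<open>s^(m+1) exp(-s)\<close>, which tends to 0; from the left it is identically 0.\<close>
    have "((\<lambda>h. inverse h ^ (m + 1) / exp (inverse h)) \<longlongrightarrow> 0) (at_right (0::real))"
      by (rule filterlim_compose[OF tendsto_power_div_exp_0 filterlim_inverse_at_top_right])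
    moreover have "\<forall>\<^sub>F h in at_right 0. inverse h ^ (m + 1) / exp (inverse h) = (flat m (0 + h) - flat m 0) / h"
      unfolding eventually_at_filter
      by (rule always_eventually) (auto simp: flat_def exp_minus field_simps)
    ultimately have right: "((\<lambda>h. (flat m (0 + h) - flat m 0) / h) \<longlongrightarrow> 0) (at_right 0)"
      using tendsto_cong by fast
    have "\<forall>\<^sub>F h in at_left 0. 0 = (flat m (0 + h) - flat m 0) / h"
      unfolding eventually_at_filter
      by (rule always_eventually) (auto simp: flat_def)
    then have "((\<lambda>h. (flat m (0 + h) - flat m 0) / h) \<longlongrightarrow> 0) (at_left 0)"
      using tendsto_cong tendsto_const by fast
    with right have "((\<lambda>h. (flat m (0 + h) - flat m 0) / h) \<longlongrightarrow> 0) (at 0)"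
      by (simp add: filterlim_split_at)
    then show ?thesis using 3 by (simp add: DERIV_def flat_def)
  qed
qed

lemma smooth_on_flat: "smooth_on UNIV (flat m)"
proof -
  have "C_k_on n UNIV (flat m)" for n
  proof (induction n arbitrary: m)
    case 0
    show ?case
      using DERIV_isCont[OF flat_has_derivative] by (simp add: continuous_on_eq_continuous_at)
  next
    case (Suc n)
    have "C_k_on n UNIV (\<lambda>t. (- real m) * flat (m + 1) t)"
      by (intro bounded_bilinear.C_k_on_prod[OF bounded_bilinear_mult] C_k_on_const Suc open_UNIV)
    then have "C_k_on n UNIV (\<lambda>t. flat (m + 2) t + (- real m) * flat (m + 1) t)"
      using Suc by (intro C_k_on_add) auto
    then show ?case
      using flat_has_derivative by (intro C_k_on_real_derivative) auto
  qed
  then show ?thesis by (simp add: smooth_on_def)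
qed

text \<open>The derivative is again a polynomial in \<open>inverse\<close>, so the product rule
  closes the induction.\<close>

lemma smooth_on_inverse: "smooth_on (- {0}) (inverse :: real \<Rightarrow> real)"
proof -
  have "C_k_on n (- {0}) (inverse :: real \<Rightarrow> real)" for n
  proof (induction n)
    case 0
    show ?case by (auto intro!: continuous_intros)
  next
    case (Suc n)
    have "C_k_on n (- {0}) (\<lambda>x::real. (- 1) * (inverse x * inverse x))"
      by (intro bounded_bilinear.C_k_on_prod[OF bounded_bilinear_mult] C_k_on_const Suc) auto
    then show ?case
      by (intro C_k_on_real_derivative) (auto intro!: derivative_eq_intros)
  qed
  then show ?thesis by (simp add: smooth_on_def)
qed

text \<open>The usual quotient \<open>f(b-t) / (f(b-t) + f(t-a))\<close> with
  \<open>f = flat 0\<close>, that is \<open>exp(-1/t)\<close> for positive \<open>t\<close> and 0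
  elsewhere. As \<open>a < b\<close>, one of \<open>b - t\<close> and \<open>t - a\<close> is always
  positive, and so is the denominator.\<close>

lemma smooth_cutoff_real:
  fixes a b :: real
  assumes "a < b"
  obtains h :: "real \<Rightarrow> real"
  where "smooth_on UNIV h" "\<And>t. t \<le> a \<Longrightarrow> h t = 1" "\<And>t. t \<ge> b \<Longrightarrow> h t = 0"
proof
  let ?n = "\<lambda>t. flat 0 (b - t)" and ?d = "\<lambda>t. flat 0 (b - t) + flat 0 (t - a)"
  have pos: "?d t > 0" for t
    using assms by (auto simp: flat_def add_pos_pos)
  have id: "smooth_on UNIV (\<lambda>t::real. t)"
  proof -
    have "C_k_on n UNIV (\<lambda>t::real. t)" for n
      by (cases n) (auto simp: C_k_on_const)
    then show ?thesis by (simp add: smooth_on_def)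
  qed
  have n: "smooth_on UNIV ?n" and d: "smooth_on UNIV ?d"
    by (auto intro!: smooth_on_add smooth_on_compose_real[OF _ _ smooth_on_flat]
        smooth_on_diff id smooth_on_const)
  have "smooth_on UNIV (\<lambda>t. inverse (?d t))"
    by (intro smooth_on_compose_real[OF _ d smooth_on_inverse])
      (use pos in \<open>auto simp: less_le\<close>)
  then show "smooth_on UNIV (\<lambda>t. ?n t * inverse (?d t))"
    by (intro smooth_on_mult n) auto
  show "?n t * inverse (?d t) = 1" if "t \<le> a" for t
    using that assms by (simp add: flat_def)
  show "?n t * inverse (?d t) = 0" if "t \<ge> b" for t
    using that by (simp add: flat_def)
qed

section \<open>Cosets\<close>

lemma elt_set_plus_eq_iff:
  assumes "subspace B"
  shows "x +o B = y +o B \<longleftrightarrow> x - y \<in> B"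
proof
  assume "x +o B = y +o B"
  then have "x \<in> y +o B"
    using subspace_0[OF assms] by (force simp: elt_set_plus_def)
  then show "x - y \<in> B" by (rule set_plus_imp_minus)
next
  assume d: "x - y \<in> B"
  show "x +o B = y +o B"
  proof (intro set_eqI)
    fix z
    have "z - y = (z - x) + (x - y)" "z - x = (z - y) - (x - y)" by auto
    then have "z - x \<in> B \<longleftrightarrow> z - y \<in> B"
      using d subspace_add[OF assms] subspace_diff[OF assms] by metis
    then show "z \<in> x +o B \<longleftrightarrow> z \<in> y +o B" by (simp add: set_minus_plus)
  qed
qed

lemma coset_lincomb_eq:
  assumes "subspace B" "finite S" "\<And>X. X \<in> S \<Longrightarrow> X = z X +o B"
  shows "coset_lincomb B a S = (\<Sum>X\<in>S. a X *\<^sub>R z X) +o B"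
  using assms(2,3)
proof (induction S rule: finite_induct)
  case empty
  then show ?case by (simp add: coset_lincomb_def)
next
  case (insert X S)
  have "coset_lincomb B a (insert X S) = (\<lambda>x. a X *\<^sub>R x) ` X + coset_lincomb B a S"
    using insert by (simp add: coset_lincomb_def add.assoc)
  also have "\<dots> = (\<lambda>x. a X *\<^sub>R x) ` (z X +o B) + ((\<Sum>X\<in>S. a X *\<^sub>R z X) +o B)" (is "_ = ?A + (?s +o B)")
    using insert by simp
  also have "\<dots> = (a X *\<^sub>R z X + ?s) +o B"
  proof (intro set_eqI iffI)
    fix w assume "w \<in> ?A + (?s +o B)"
    then obtain b c where "b \<in> B" "c \<in> B" "w = a X *\<^sub>R (z X + b) + (?s + c)"
      by (auto simp: set_plus_def elt_set_plus_def)
    then show "w \<in> (a X *\<^sub>R z X + ?s) +o B"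
      using subspace_add[OF assms(1) subspace_scale[OF assms(1)], of b c "a X"]
      by (force simp: elt_set_plus_def algebra_simps)
  next
    fix w assume "w \<in> (a X *\<^sub>R z X + ?s) +o B"
    \<comment> \<open>The whole error \<open>b\<close> goes into the last summand, since
      \<open>a X\<close> may be zero and cannot be divided by.\<close>
    then obtain b where "b \<in> B" "w = a X *\<^sub>R (z X + 0) + (?s + b)"
      by (auto simp: elt_set_plus_def algebra_simps)
    then show "w \<in> ?A + (?s +o B)"
      using subspace_0[OF assms(1)] by (auto simp: set_plus_def elt_set_plus_def)
  qed
  finally show ?case using insert by simp
qed

lemma coset_lincomb_eq_zero_iff:
  assumes "subspace B" "finite S" "\<And>X. X \<in> S \<Longrightarrow> X = z X +o B"
  shows "coset_lincomb B a S = B \<longleftrightarrow> (\<Sum>X\<in>S. a X *\<^sub>R z X) \<in> B"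
proof -
  have "coset_lincomb B a S = B \<longleftrightarrow> (\<Sum>X\<in>S. a X *\<^sub>R z X) +o B = 0 +o B"
    by (simp only: coset_lincomb_eq[OF assms, where a = a] set_zero_plus)
  then show ?thesis
    by (simp only: elt_set_plus_eq_iff[OF assms(1)] diff_zero)
qed

text \<open>\<open>R\<close> induces a linear map of quotients that reaches every class of
  \<open>Z\<close> modulo \<open>B\<close> from a class of \<open>Z'\<close> modulo
  \<open>B'\<close>. Preimages of independent classes are independent, because \<open>R\<close>
  carries a linear relation modulo \<open>B'\<close> to the same relation modulo
  \<open>B\<close>.\<close>

lemma quotient_dim_le:
  fixes R :: "'w::real_vector \<Rightarrow> 'v::real_vector"
  assumes B: "subspace B" and B': "subspace B'" and R: "linear R" "R ` B' \<subseteq> B"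
    and lift: "\<And>z. z \<in> Z \<Longrightarrow> \<exists>e\<in>Z'. z - R e \<in> B"
  shows "quotient_dim Z B \<le> quotient_dim Z' B'"
  unfolding quotient_dim_def
proof (rule SUP_mono, safe)
  fix S assume S: "S \<subseteq> quotient_space Z B" "coset_independent B S"
  have "\<exists>e\<in>Z'. X = R e +o B" if "X \<in> S" for X
  proof -
    obtain z where z: "z \<in> Z" "X = z +o B"
      using \<open>X \<in> S\<close> S(1) by (auto simp: quotient_space_def)
    with lift obtain e where "e \<in> Z'" "z - R e \<in> B" by blast
    with z show ?thesis by (metis elt_set_plus_eq_iff[OF B])
  qed
  then obtain e where e: "\<And>X. X \<in> S \<Longrightarrow> e X \<in> Z'" "\<And>X. X \<in> S \<Longrightarrow> X = R (e X) +o B"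
    by metis
  define T where "T X = e X +o B'" for X
  \<comment> \<open>Equal lifts have equal images under \<open>R\<close>, so passing to lifts does
    not lower the cardinality.\<close>
  have inj: "inj_on T S"
  proof
    fix X Y assume XY: "X \<in> S" "Y \<in> S" "T X = T Y"
    then have "R (e X - e Y) \<in> B"
      using elt_set_plus_eq_iff[OF B'] R(2) by (auto simp: T_def)
    then have "R (e X) +o B = R (e Y) +o B"
      using elt_set_plus_eq_iff[OF B] R(1) by (simp add: linear_diff)
    then show "X = Y" using XY e(2) by metis
  qed
  have fin: "finite S" using S(2) by (simp add: coset_independent_def)
  have "coset_independent B' (T ` S)"
    unfolding coset_independent_def
  proof (intro conjI allI impI)
    fix a assume "coset_lincomb B' a (T ` S) = B'"
    \<comment> \<open>\<open>inv_into S T\<close> leads from a lifted coset back to the original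
      one, whose chosen \<open>e\<close> represents the lift.\<close>
    then have "(\<Sum>X\<in>T ` S. a X *\<^sub>R e (inv_into S T X)) \<in> B'"
      by (subst (asm) coset_lincomb_eq_zero_iff[OF B', where z = "\<lambda>X. e (inv_into S T X)"])
        (use fin inj in \<open>auto simp: T_def[symmetric]\<close>)
    then have "(\<Sum>X\<in>S. a (T X) *\<^sub>R e X) \<in> B'"
      using inj by (simp add: sum.reindex)
    then have "R (\<Sum>X\<in>S. a (T X) *\<^sub>R e X) \<in> B" using R(2) by blast
    then have "(\<Sum>X\<in>S. a (T X) *\<^sub>R R (e X)) \<in> B"
      using R(1) by (simp add: linear_sum linear_scale)
    then have "coset_lincomb B (\<lambda>X. a (T X)) S = B"
      using coset_lincomb_eq_zero_iff[OF B fin e(2)] by blast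
    then show "\<forall>X\<in>T ` S. a X = 0"
      using S(2) unfolding coset_independent_def by fastforce
  qed (use fin in simp)
  moreover have "T ` S \<subseteq> quotient_space Z' B'"
    using e(1) by (auto simp: quotient_space_def T_def)
  ultimately show "\<exists>T\<in>{S. S \<subseteq> quotient_space Z' B' \<and> coset_independent B' S}.
      enat (card S) \<le> enat (card T)"
    using inj by (auto intro!: exI[of _ "T ` S"] simp: card_image)
qed

section \<open>Wedge products with a 1-form\<close>

text \<open>Names the list with one omitted slot that \<open>local_ext_deriv\<close> writes
  out.\<close>

definition remove_nth :: "nat \<Rightarrow> 'v list \<Rightarrow> 'v list"
  where "remove_nth j vs = take j vs @ drop (Suc j) vs"

lemma length_remove_nth: "j < length vs \<Longrightarrow> length (remove_nth j vs) = length vs - 1"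
  by (simp add: remove_nth_def)

lemma set_remove_nth: "set (remove_nth j vs) \<subseteq> set vs"
  by (auto simp: remove_nth_def dest: in_set_takeD in_set_dropD)

lemma nth_remove_nth:
  "j < length vs \<Longrightarrow> i < length vs - 1 \<Longrightarrow>
    remove_nth j vs ! i = (if i < j then vs ! i else vs ! Suc i)"
  by (auto simp: remove_nth_def nth_append)

lemma map_remove_nth: "map f (remove_nth j vs) = remove_nth j (map f vs)"
  by (simp add: remove_nth_def take_map drop_map)

text \<open>The simplicial identity: taking out the earlier entry first shifts the index of the
  later one down by one. This shift is the source of all sign cancellations below.\<close>

lemma remove_nth_remove_nth:
  assumes "i < j" "j < length vs"
  shows "remove_nth i (remove_nth j vs) = remove_nth (j - 1) (remove_nth i vs)"
  by (rule nth_equalityI) (use assms in \<open>auto simp: length_remove_nth nth_remove_nth\<close>)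

lemma remove_nth_update:
  assumes "i < length vs" "j < length vs"
  shows "remove_nth i (vs[j := x]) =
    (if i = j then remove_nth i vs
     else (remove_nth i vs)[(if j < i then j else j - 1) := x])"
  by (rule nth_equalityI)
    (use assms in \<open>auto simp: length_remove_nth nth_remove_nth nth_list_update\<close>)

text \<open>The same two entries can be removed in either order, and exchanging the order changes
  \<open>i + j\<close> by one, hence the sign. For \<open>F\<close> symmetric in its first two
  arguments the sum therefore vanishes, which is the mechanism behind
  \<open>d d = 0\<close>.\<close>

lemma remove_two_alternating_sum:
  fixes F :: "'v \<Rightarrow> 'v \<Rightarrow> 'v list \<Rightarrow> real"
  defines "P \<equiv> \<lambda>ws. {..<length ws} \<times> {..<length ws - 1}"
  shows "(\<Sum>(i,j)\<in>P ws. (-1) ^ (i + j) * F (ws ! i) (remove_nth i ws ! j) (remove_nth j (remove_nth i ws))) =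
    - (\<Sum>(i,j)\<in>P ws. (-1) ^ (i + j) * F (remove_nth i ws ! j) (ws ! i) (remove_nth j (remove_nth i ws)))"
proof -
  \<comment> \<open>reindex by exchanging the order in which the two entries are removed\<close>
  define w where "w = (\<lambda>(i, j). if j < i then (j, i - 1) else (Suc j, i :: nat))"
  show ?thesis
    unfolding sum_negf[symmetric]
  proof (rule sum.reindex_bij_witness[of _ w w])
    fix p assume p: "p \<in> P ws"
    obtain i j where ij: "p = (i, j)" "i < length ws" "j < length ws - 1"
      using p by (auto simp: P_def)
    show "w (w p) = p" "w (w p) = p" "w p \<in> P ws" "w p \<in> P ws"
      using ij by (auto simp: w_def P_def)
    show "- (case w p of (i, j) \<Rightarrow>
        (-1) ^ (i + j) * F (remove_nth i ws ! j) (ws ! i) (remove_nth j (remove_nth i ws))) =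
      (case p of (i, j) \<Rightarrow>
        (-1) ^ (i + j) * F (ws ! i) (remove_nth i ws ! j) (remove_nth j (remove_nth i ws)))"
    proof (cases "j < i")
      case True
      then have "(-1::real) ^ (i + j) = - ((-1) ^ (j + (i - 1)))"
        by (cases i) (auto simp: add.commute)
      moreover have "\<not> i - 1 < j" "Suc (i - 1) = i" using True by auto
      ultimately show ?thesis
        using ij True remove_nth_remove_nth[of j i ws]
        by (simp add: w_def nth_remove_nth)
    next
      case False
      then show ?thesis
        using ij remove_nth_remove_nth[of i "Suc j" ws]
        by (simp add: w_def nth_remove_nth add.commute)
    qed
  qed
qed

text \<open>The exterior product of a 1-form with \<open>\<beta>\<close>, as a signed sum over the
  slot handed to \<open>\<alpha>\<close>, without factorials. Signs and normalisation match
  \<open>local_ext_deriv\<close>, so that the Leibniz rule holds without constants.\<close>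

definition wedge1 :: "('v \<Rightarrow> real) \<Rightarrow> ('v list \<Rightarrow> real) \<Rightarrow> 'v list \<Rightarrow> real"
  where "wedge1 \<alpha> \<beta> vs = (\<Sum>j<length vs. (-1) ^ j * (\<alpha> (vs ! j) * \<beta> (remove_nth j vs)))"

section \<open>Alternating forms and permutations of their arguments\<close>

lemma alternating_formsD:
  assumes "f \<in> alternating_forms k V"
  shows "\<not> (length vs = k \<and> set vs \<subseteq> V) \<Longrightarrow> f vs = 0"
    and "length vs = k \<Longrightarrow> set vs \<subseteq> V \<Longrightarrow> j < k \<Longrightarrow> x \<in> V \<Longrightarrow> y \<in> V \<Longrightarrow>
      f (vs[j := x + y]) = f (vs[j := x]) + f (vs[j := y])"
    and "length vs = k \<Longrightarrow> set vs \<subseteq> V \<Longrightarrow> j < k \<Longrightarrow> x \<in> V \<Longrightarrow>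
      f (vs[j := c *\<^sub>R x]) = c * f (vs[j := x])"
    and "length vs = k \<Longrightarrow> set vs \<subseteq> V \<Longrightarrow> i < j \<Longrightarrow> j < k \<Longrightarrow> vs ! i = vs ! j \<Longrightarrow> f vs = 0"
  using assms unfolding alternating_forms_def by blast+

lemma subspace_alternating_forms: "subspace (alternating_forms k V)"
  unfolding subspace_def alternating_forms_def
  by (auto simp: scaleR_fun_def algebra_simps)

text \<open>Polarisation: expanding the vanishing value at two equal adjacent arguments
  \<open>a + b\<close> leaves only the two mixed terms.\<close>

lemma alternating_forms_swap_adjacent:
  assumes f: "f \<in> alternating_forms k V" and V: "subspace V"
    and "length (xs @ a # b # ys) = k" "set (xs @ a # b # ys) \<subseteq> V"
  shows "f (xs @ a # b # ys) = - f (xs @ b # a # ys)"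
proof -
  let ?n = "length xs"
  define g where "g x y = f (xs @ x # y # ys)" for x y
  have ab: "a \<in> V" "b \<in> V" "a + b \<in> V" and xy: "set xs \<subseteq> V" "set ys \<subseteq> V"
    using assms V by (auto intro: subspace_add)
  have l: "g (x + x') y = g x y + g x' y" if "x \<in> V" "x' \<in> V" "y \<in> V" for x x' y
    using alternating_formsD(2)[OF f, of "xs @ x # y # ys" ?n x x'] that xy assms(3)
    by (simp add: g_def list_update_append)
  have r: "g x (y + y') = g x y + g x y'" if "x \<in> V" "y \<in> V" "y' \<in> V" for x y y'
    using alternating_formsD(2)[OF f, of "xs @ x # y # ys" "Suc ?n" y y'] that xy assms(3)
    by (simp add: g_def list_update_append)
  have z: "g x x = 0" if "x \<in> V" for x
    using alternating_formsD(4)[OF f, of "xs @ x # x # ys" ?n "Suc ?n"] that xy assms(3)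
    by (simp add: g_def nth_append)
  have "0 = g (a + b) (a + b)" using z ab by simp
  also have "\<dots> = g a (a + b) + g b (a + b)" using l ab by blast
  also have "\<dots> = g a b + g b a" using r z ab by simp
  finally show ?thesis by (simp add: g_def)
qed

text \<open>One adjacent swap for each entry of \<open>ys\<close>. It serves to compare the two
  lists that arise by omitting one or the other of two equal arguments.\<close>

lemma alternating_forms_move:
  assumes f: "f \<in> alternating_forms k V" and V: "subspace V"
    and "length (xs @ a # ys @ zs) = k" "set (xs @ a # ys @ zs) \<subseteq> V"
  shows "f (xs @ a # ys @ zs) = (-1) ^ length ys * f (xs @ ys @ a # zs)"
  using assms(3,4)
proof (induction ys arbitrary: xs)
  case (Cons b ys)
  have "f (xs @ a # b # ys @ zs) = - f ((xs @ [b]) @ a # ys @ zs)"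
    using Cons.prems alternating_forms_swap_adjacent[OF f V, of xs a b "ys @ zs"] by simp
  also have "f ((xs @ [b]) @ a # ys @ zs) = (-1) ^ length ys * f ((xs @ [b]) @ ys @ a # zs)"
    using Cons.prems by (intro Cons.IH) auto
  finally show ?case by simp
qed simp

lemma wedge1_alternating:
  assumes \<beta>: "\<beta> \<in> alternating_forms k V" and V: "subspace V"
    and add: "\<And>x y. x \<in> V \<Longrightarrow> y \<in> V \<Longrightarrow> \<alpha> (x + y) = \<alpha> x + \<alpha> y"
    and scale: "\<And>c x. x \<in> V \<Longrightarrow> \<alpha> (c *\<^sub>R x) = c * \<alpha> x"
  shows "(\<lambda>vs. if length vs = Suc k \<and> set vs \<subseteq> V then wedge1 \<alpha> \<beta> vs else 0)
    \<in> alternating_forms (Suc k) V"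
proof -
  have upd: "set (vs[j := x]) \<subseteq> V" if "set vs \<subseteq> V" "x \<in> V" for vs j x
    using that set_update_subset_insert[of vs j x] by blast
  have rem: "set (remove_nth i vs) \<subseteq> V" if "set vs \<subseteq> V" for vs i
    using that set_remove_nth by fast
  have A: "wedge1 \<alpha> \<beta> (vs[j := x + y]) = wedge1 \<alpha> \<beta> (vs[j := x]) + wedge1 \<alpha> \<beta> (vs[j := y])"
    if "length vs = Suc k" "set vs \<subseteq> V" "j < Suc k" "x \<in> V" "y \<in> V" for vs j x y
    unfolding wedge1_def length_list_update sum.distrib[symmetric]
  proof (rule sum.cong, goal_cases)
    case (2 i)
    show ?case
    proof (cases "i = j")
      case True
      then show ?thesis using that 2 by (simp add: remove_nth_update add algebra_simps)
    next
      case False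
      \<comment> \<open>The position of slot \<open>j\<close> once slot \<open>i\<close> has been
        removed.\<close>
      define l where "l = (if j < i then j else j - 1)"
      have "l < k" "i < length vs" "j < length vs"
        using that 2 False by (auto simp: l_def)
      then show ?thesis
        using that False alternating_formsD(2)[OF \<beta>, of "remove_nth i vs" l x y] rem[of vs i]
        by (simp add: remove_nth_update length_remove_nth algebra_simps flip: l_def)
    qed
  qed simp
  have B: "wedge1 \<alpha> \<beta> (vs[j := c *\<^sub>R x]) = c * wedge1 \<alpha> \<beta> (vs[j := x])"
    if "length vs = Suc k" "set vs \<subseteq> V" "j < Suc k" "x \<in> V" for vs j c x
    unfolding wedge1_def length_list_update sum_distrib_left
  proof (rule sum.cong, goal_cases)
    case (2 i)
    show ?case
    proof (cases "i = j")
      case True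
      then show ?thesis using that 2 by (simp add: remove_nth_update scale algebra_simps)
    next
      case False
      define l where "l = (if j < i then j else j - 1)"
      have "l < k" "i < length vs" "j < length vs"
        using that 2 False by (auto simp: l_def)
      then show ?thesis
        using that False alternating_formsD(3)[OF \<beta>, of "remove_nth i vs" l x c] rem[of vs i]
        by (simp add: remove_nth_update length_remove_nth algebra_simps flip: l_def)
    qed
  qed simp
  \<comment> \<open>Every summand that omits a slot other than \<open>i\<close> and \<open>j\<close>
    still feeds two equal entries to \<open>\<beta>\<close> and vanishes. The two remaining summands
    cancel: moving the repeated entry from one place to the other takes \<open>j - i - 1\<close>
    swaps.\<close>
  have C: "wedge1 \<alpha> \<beta> vs = 0"
    if vs: "length vs = Suc k" "set vs \<subseteq> V" "i < j" "j < Suc k" "vs ! i = vs ! j" for vs i j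
  proof -
    have "\<beta> (remove_nth l vs) = 0" if "l < Suc k" "l \<noteq> i" "l \<noteq> j" for l
      by (rule alternating_formsD(4)[OF \<beta>, of _ "if i < l then i else i - 1" "if j < l then j else j - 1"])
        (use that vs rem[of vs l] in \<open>auto simp: length_remove_nth nth_remove_nth\<close>)
    then have "wedge1 \<alpha> \<beta> vs = (\<Sum>l\<in>{i, j}. (-1) ^ l * (\<alpha> (vs ! l) * \<beta> (remove_nth l vs)))"
      unfolding wedge1_def using vs by (intro sum.mono_neutral_right) auto
    also have "\<dots> = \<alpha> (vs ! i) * ((-1) ^ i * \<beta> (remove_nth i vs) + (-1) ^ j * \<beta> (remove_nth j vs))"
      using vs by (simp add: algebra_simps)
    also have "(-1) ^ i * \<beta> (remove_nth i vs) + (-1) ^ j * \<beta> (remove_nth j vs) = 0"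
    proof -
      define xs ys zs where "xs = take i vs" and "ys = take (j - Suc i) (drop (Suc i) vs)"
        and "zs = drop (Suc j) vs"
      have d: "drop (Suc i) vs = ys @ vs ! j # zs"
        using vs id_take_nth_drop[of "j - Suc i" "drop (Suc i) vs"]
        by (simp add: ys_def zs_def)
      have e: "vs = xs @ vs ! i # ys @ vs ! i # zs"
        using vs id_take_nth_drop[of i vs] d by (simp add: xs_def)
      have lens: "length xs = i" "length ys = j - Suc i"
        using vs by (auto simp: xs_def ys_def)
      have i: "remove_nth i vs = xs @ ys @ vs ! i # zs"
        using d vs by (simp add: remove_nth_def xs_def)
      have "take j vs = xs @ vs ! i # ys"
        using lens vs(3) e append_eq_conv_conj[of "xs @ vs ! i # ys" "vs ! i # zs" vs] by simp
      then have j: "remove_nth j vs = xs @ vs ! i # ys @ zs"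
        by (simp add: remove_nth_def zs_def)
      have "set (xs @ vs ! i # ys @ zs) \<subseteq> V" "length (xs @ vs ! i # ys @ zs) = k"
        using rem[of vs j] length_remove_nth[of j vs] vs j by auto
      then have "\<beta> (remove_nth j vs) = (-1) ^ (j - Suc i) * \<beta> (remove_nth i vs)"
        unfolding i j using alternating_forms_move[OF \<beta> V] lens by metis
      \<comment> \<open>The exponents add up to \<open>2 j - i - 1\<close>, whose parity is opposite
        to that of \<open>i\<close>.\<close>
      moreover have "(-1::real) ^ j * (-1) ^ (j - Suc i) = - ((-1) ^ i)"
      proof -
        obtain d where "j = Suc (i + d)" using vs(3) less_imp_Suc_add by blast
        then show ?thesis by (simp add: power_add mult.assoc flip: power_mult_distrib)
      qed
      ultimately show ?thesis by (simp add: mult.assoc[symmetric])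
    qed
    finally show ?thesis by simp
  qed
  show ?thesis
    unfolding alternating_forms_def mem_Collect_eq
  proof (intro conjI allI impI; (elim conjE)?)
    fix vs i j assume "length vs = Suc k" "set vs \<subseteq> V" "i < j" "j < Suc k" "vs ! i = vs ! j"
    then show "(if length vs = Suc k \<and> set vs \<subseteq> V then wedge1 \<alpha> \<beta> vs else 0) = 0"
      using C[of vs i j] by simp
  qed (auto simp: upd A B V subspace_add subspace_scale)
qed

section \<open>The exterior derivative in coordinates\<close>

lemma local_ext_deriv_remove_nth:
  "local_ext_deriv \<eta> x ws =
    (\<Sum>j<length ws. (-1) ^ j * frechet_derivative (\<lambda>y. \<eta> y (remove_nth j ws)) (at x) (ws ! j))"
  by (simp add: local_ext_deriv_def remove_nth_def)

lemma local_ext_deriv_cong: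
  assumes "open S" "x \<in> S" "\<And>y vs. y \<in> S \<Longrightarrow> length vs = length ws - 1 \<Longrightarrow> \<eta> y vs = \<theta> y vs"
  shows "local_ext_deriv \<eta> x ws = local_ext_deriv \<theta> x ws"
proof -
  have "frechet_derivative (\<lambda>y. \<eta> y (remove_nth j ws)) (at x) =
      frechet_derivative (\<lambda>y. \<theta> y (remove_nth j ws)) (at x)" if "j < length ws" for j
    by (rule frechet_derivative_cong_open[OF assms(1,2)])
      (rule assms(3), use that in \<open>simp_all add: length_remove_nth\<close>)
  then show ?thesis
    unfolding local_ext_deriv_remove_nth by (intro sum.cong refl) simp
qed

lemma local_ext_deriv_add:
  assumes "\<And>vs. length vs = length ws - 1 \<Longrightarrow> (\<lambda>y. \<eta> y vs) differentiable (at x)"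
    "\<And>vs. length vs = length ws - 1 \<Longrightarrow> (\<lambda>y. \<theta> y vs) differentiable (at x)"
  shows "local_ext_deriv (\<lambda>y vs. \<eta> y vs + \<theta> y vs) x ws =
    local_ext_deriv \<eta> x ws + local_ext_deriv \<theta> x ws"
  unfolding local_ext_deriv_remove_nth sum.distrib[symmetric]
  by (intro sum.cong refl) (simp add: frechet_derivative_add assms length_remove_nth algebra_simps)

text \<open>The product rule in each summand of the alternating sum; the derivatives that fall on
  \<open>f\<close> collect to \<open>df \<and> \<eta>\<close>.\<close>

lemma local_ext_deriv_mult:
  assumes "f differentiable (at x)"
    "\<And>vs. length vs = length ws - 1 \<Longrightarrow> (\<lambda>y. \<eta> y vs) differentiable (at x)"
  shows "local_ext_deriv (\<lambda>y vs. f y * \<eta> y vs) x ws =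
    f x * local_ext_deriv \<eta> x ws + wedge1 (frechet_derivative f (at x)) (\<eta> x) ws"
  unfolding local_ext_deriv_remove_nth wedge1_def sum_distrib_left sum.distrib[symmetric]
  by (intro sum.cong refl) (simp add: frechet_derivative_mult assms length_remove_nth algebra_simps)

text \<open>Second derivatives of \<open>f\<close> cancel in pairs by symmetry, which amounts to
  \<open>d d f = 0\<close>. In the other terms the minus sign comes from exchanging the slot used
  for differentiating \<open>\<eta>\<close> with the slot handed to \<open>df\<close>.\<close>

lemma local_ext_deriv_wedge1:
  assumes "open S" "x \<in> S" "smooth_on S f"
    and \<eta>: "\<And>vs. length vs = m \<Longrightarrow> (\<lambda>y. \<eta> y vs) differentiable (at x)"
    and ws: "length ws = m + 2"
  shows "local_ext_deriv (\<lambda>y. wedge1 (frechet_derivative f (at y)) (\<eta> y)) x ws =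
    - wedge1 (frechet_derivative f (at x)) (local_ext_deriv \<eta> x) ws"
proof -
  let ?D = "\<lambda>u y. frechet_derivative f (at y) u"
  let ?D2 = "\<lambda>u v. frechet_derivative (?D v) (at x) u"
  let ?E = "\<lambda>u vs. frechet_derivative (\<lambda>y. \<eta> y vs) (at x) u"
  let ?r = "\<lambda>i j. remove_nth j (remove_nth i ws)"
  let ?P = "{..<length ws} \<times> {..<length ws - 1}"
  have D: "?D u differentiable (at x)" for u
    using smooth_on_frechet_derivative[OF assms(3)] assms(2) by (rule smooth_on_imp_differentiable)
  have len: "length (?r i j) = m" if "i < length ws" "j < length ws - 1" for i j
    using that ws by (simp add: length_remove_nth)
  have deriv_summand: "frechet_derivative (\<lambda>y. wedge1 (frechet_derivative f (at y)) (\<eta> y) (remove_nth i ws)) (at x) (ws ! i) =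
    (\<Sum>j<length ws - 1. (-1) ^ j * (?D2 (ws ! i) (remove_nth i ws ! j) * \<eta> x (?r i j) +
      ?D (remove_nth i ws ! j) x * ?E (ws ! i) (?r i j)))" if i: "i < length ws" for i
  proof -
    have "frechet_derivative (\<lambda>y. wedge1 (frechet_derivative f (at y)) (\<eta> y) (remove_nth i ws)) (at x) (ws ! i) =
      frechet_derivative (\<lambda>y. \<Sum>j<length ws - 1. (-1) ^ j * (?D (remove_nth i ws ! j) y * \<eta> y (?r i j))) (at x) (ws ! i)"
      using i by (simp add: wedge1_def length_remove_nth)
    also have "\<dots> = (\<Sum>j<length ws - 1. frechet_derivative
        (\<lambda>y. (-1) ^ j * (?D (remove_nth i ws ! j) y * \<eta> y (?r i j))) (at x) (ws ! i))"
      by (rule frechet_derivative_sum) (use i D \<eta> len in \<open>auto intro!: differentiable_mult\<close>)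
    also have "\<dots> = (\<Sum>j<length ws - 1. (-1) ^ j * (?D2 (ws ! i) (remove_nth i ws ! j) * \<eta> x (?r i j) +
      ?D (remove_nth i ws ! j) x * ?E (ws ! i) (?r i j)))"
      by (intro sum.cong refl)
        (use i D \<eta> len in \<open>simp add: frechet_derivative_mult differentiable_mult algebra_simps\<close>)
    finally show ?thesis .
  qed
  have "local_ext_deriv (\<lambda>y. wedge1 (frechet_derivative f (at y)) (\<eta> y)) x ws =
    (\<Sum>i<length ws. \<Sum>j<length ws - 1. (-1) ^ (i + j) * (?D2 (ws ! i) (remove_nth i ws ! j) * \<eta> x (?r i j) +
      ?D (remove_nth i ws ! j) x * ?E (ws ! i) (?r i j)))"
    unfolding local_ext_deriv_remove_nth
    by (intro sum.cong refl) (simp add: deriv_summand sum_distrib_left power_add mult.assoc)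
  also have "\<dots> = (\<Sum>(i,j)\<in>?P. (-1) ^ (i + j) * (?D2 (ws ! i) (remove_nth i ws ! j) * \<eta> x (?r i j))) +
      (\<Sum>(i,j)\<in>?P. (-1) ^ (i + j) * (?D (remove_nth i ws ! j) x * ?E (ws ! i) (?r i j)))"
    unfolding sum.cartesian_product sum.distrib[symmetric]
    by (intro sum.cong) (auto simp: algebra_simps)
  \<comment> \<open>By symmetry this sum equals its own negative.\<close>
  also have "(\<Sum>(i,j)\<in>?P. (-1) ^ (i + j) * (?D2 (ws ! i) (remove_nth i ws ! j) * \<eta> x (?r i j))) = 0"
  proof -
    have "?D2 u v = ?D2 v u" for u v
      by (rule symmetric_second_derivative[OF assms(1-3)])
    then show ?thesis
      using remove_two_alternating_sum[of "\<lambda>u v vs. ?D2 u v * \<eta> x vs" ws] by simp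
  qed
  also have "(\<Sum>(i,j)\<in>?P. (-1) ^ (i + j) * (?D (remove_nth i ws ! j) x * ?E (ws ! i) (?r i j))) =
    - (\<Sum>(i,j)\<in>?P. (-1) ^ (i + j) * (?D (ws ! i) x * ?E (remove_nth i ws ! j) (?r i j)))"
    by (rule remove_two_alternating_sum[of "\<lambda>u v vs. ?D v x * ?E u vs"])
  also have "(\<Sum>(i,j)\<in>?P. (-1) ^ (i + j) * (?D (ws ! i) x * ?E (remove_nth i ws ! j) (?r i j))) =
    wedge1 (frechet_derivative f (at x)) (local_ext_deriv \<eta> x) ws"
    unfolding sum.cartesian_product[symmetric] wedge1_def local_ext_deriv_remove_nth
    by (intro sum.cong refl) (simp add: length_remove_nth sum_distrib_left power_add mult_ac)
  finally show ?thesis by simp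
qed

section \<open>Charts and tangent spaces\<close>

lemma charts_atI: "i \<in> idx M \<Longrightarrow> p \<in> cdom M i \<Longrightarrow> i \<in> charts_at M p"
  by (simp add: charts_at_def)

lemma charts_at_submanifold: "p \<in> V \<Longrightarrow> charts_at (open_submanifold M V) p = charts_at M p"
  by (simp add: charts_at_def open_submanifold_def)

context
  fixes M :: "('i, 'a, 'e::{real_inner,heine_borel}) manifold"
  assumes M: "smooth_manifold M"
begin

lemma cdom_subset_topspace: "i \<in> idx M \<Longrightarrow> cdom M i \<subseteq> topspace (mtop M)"
  using M unfolding smooth_manifold_def by blast

lemma charts_at_nonempty: "p \<in> topspace (mtop M) \<Longrightarrow> \<exists>i. i \<in> charts_at M p"
  using M unfolding smooth_manifold_def charts_at_def by blast

lemma chart_homeomorphic: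
  "i \<in> idx M \<Longrightarrow> homeomorphic_map (subtopology (mtop M) (cdom M i))
    (top_of_set (chart M i ` cdom M i)) (chart M i)"
  using M unfolding smooth_manifold_def by blast

lemma open_chart_image:
  assumes "i \<in> idx M" "openin (mtop M) W"
  shows "open (chart M i ` (cdom M i \<inter> W))"
proof -
  have "openin (subtopology (mtop M) (cdom M i)) (cdom M i \<inter> W)"
    using assms(2) by (auto simp: openin_subtopology)
  then have "openin (top_of_set (chart M i ` cdom M i)) (chart M i ` (cdom M i \<inter> W))"
    using homeomorphic_imp_open_map[OF chart_homeomorphic[OF assms(1)]] by (auto simp: open_map_def)
  moreover have "open (chart M i ` cdom M i)"
    using M assms(1) unfolding smooth_manifold_def by blast
  ultimately show ?thesis using openin_open_eq by blast
qed

lemma openin_cdom: "i \<in> idx M \<Longrightarrow> openin (mtop M) (cdom M i)"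
  using M unfolding smooth_manifold_def by blast

lemma open_chart_range: "i \<in> idx M \<Longrightarrow> open (chart M i ` cdom M i)"
  using M unfolding smooth_manifold_def by blast

lemma inj_on_chart:
  assumes "i \<in> idx M"
  shows "inj_on (chart M i) (cdom M i)"
  using homeomorphic_imp_injective_map[OF chart_homeomorphic[OF assms]] cdom_subset_topspace[OF assms]
  by (simp add: Int_absorb1)

lemma chart_inv_chart: "i \<in> idx M \<Longrightarrow> p \<in> cdom M i \<Longrightarrow> chart_inv M i (chart M i p) = p"
  unfolding chart_inv_def using inj_on_chart by simp

lemma transition_chart:
  "i \<in> idx M \<Longrightarrow> p \<in> cdom M i \<Longrightarrow> transition M i j (chart M i p) = chart M j p"
  by (simp add: transition_def chart_inv_chart)

lemma smooth_on_transition: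
  "i \<in> idx M \<Longrightarrow> j \<in> idx M \<Longrightarrow> smooth_on (chart M i ` (cdom M i \<inter> cdom M j)) (transition M i j)"
  using M unfolding smooth_manifold_def by blast

lemma transition_differentiable:
  assumes "i \<in> charts_at M p" "j \<in> charts_at M p"
  shows "transition M i j differentiable (at (chart M i p))"
  by (rule smooth_on_imp_differentiable[OF smooth_on_transition])
    (use assms in \<open>auto simp: charts_at_def\<close>)

lemma linear_transition:
  "i \<in> charts_at M p \<Longrightarrow> j \<in> charts_at M p \<Longrightarrow>
    linear (frechet_derivative (transition M i j) (at (chart M i p)))"
  by (intro linear_frechet_derivative transition_differentiable)

text \<open>Near \<open>chart M i p\<close>, the function \<open>g\<close> read in chart
  \<open>i\<close> is \<open>g\<close> read in chart \<open>j\<close> after the transition map, so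
  this is the chain rule. Taking a coordinate map for \<open>g\<close> gives the cocycle rule of
  tangent vectors; taking a smooth function shows that its differential does not depend on the
  chart.\<close>

lemma frechet_derivative_change_chart:
  fixes g :: "'a \<Rightarrow> 'b::real_normed_vector"
  assumes i: "i \<in> charts_at M p" and j: "j \<in> charts_at M p"
    and "(g \<circ> chart_inv M j) differentiable (at (chart M j p))"
  shows "frechet_derivative (g \<circ> chart_inv M i) (at (chart M i p)) w =
    frechet_derivative (g \<circ> chart_inv M j) (at (chart M j p))
      (frechet_derivative (transition M i j) (at (chart M i p)) w)"
proof -
  have ij: "i \<in> idx M" "j \<in> idx M" "p \<in> cdom M i" "p \<in> cdom M j"
    using i j by (auto simp: charts_at_def)
  have "frechet_derivative (g \<circ> chart_inv M i) (at (chart M i p)) =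
      frechet_derivative (\<lambda>x. (g \<circ> chart_inv M j) (transition M i j x)) (at (chart M i p))"
    by (rule frechet_derivative_cong_open[OF open_chart_image[OF ij(1) openin_cdom[OF ij(2)]]])
      (use ij in \<open>auto simp: transition_chart chart_inv_chart\<close>)
  then show ?thesis
    using assms(3) ij
      frechet_derivative_chain[OF transition_differentiable[OF i j], of "g \<circ> chart_inv M j" w]
    by (simp only: transition_chart)
qed

lemma transition_cocycle:
  assumes "i \<in> charts_at M p" "j \<in> charts_at M p" "k \<in> charts_at M p"
  shows "frechet_derivative (transition M i k) (at (chart M i p)) w =
    frechet_derivative (transition M j k) (at (chart M j p))
      (frechet_derivative (transition M i j) (at (chart M i p)) w)"
  using frechet_derivative_change_chart[OF assms(1,2), of "chart M k"]
    transition_differentiable[OF assms(2,3)]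
  by (simp add: transition_def)

lemma frechet_derivative_transition_self:
  assumes "i \<in> charts_at M p"
  shows "frechet_derivative (transition M i i) (at (chart M i p)) w = w"
proof -
  have i: "i \<in> idx M" "p \<in> cdom M i" using assms by (auto simp: charts_at_def)
  have "frechet_derivative (transition M i i) (at (chart M i p)) =
      frechet_derivative (\<lambda>x. x) (at (chart M i p))"
    by (rule frechet_derivative_cong_open[OF open_chart_range[OF i(1)]])
      (use i in \<open>auto simp: transition_chart\<close>)
  then show ?thesis by simp
qed

section \<open>Tangent vectors and their coordinates\<close>

lemma tangent_of_mem: "i \<in> charts_at M p \<Longrightarrow> tangent_of M i p w \<in> tangent_space M p"
  unfolding tangent_space_def tangent_of_def by (auto intro: transition_cocycle)

lemma tangent_of_component: "i \<in> charts_at M p \<Longrightarrow> tangent_of M i p w i = w"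
  by (simp add: tangent_of_def frechet_derivative_transition_self)

lemma tangent_spaceD:
  assumes "v \<in> tangent_space M p"
  shows "i \<notin> charts_at M p \<Longrightarrow> v i = 0"
    and "i \<in> charts_at M p \<Longrightarrow> j \<in> charts_at M p \<Longrightarrow>
      v j = frechet_derivative (transition M i j) (at (chart M i p)) (v i)"
  using assms unfolding tangent_space_def by blast+

lemma tangent_of_tangent:
  assumes "i \<in> charts_at M p" "v \<in> tangent_space M p"
  shows "tangent_of M i p (v i) = v"
proof
  show "tangent_of M i p (v i) j = v j" for j
    using tangent_spaceD(1)[OF assms(2), of j] tangent_spaceD(2)[OF assms(2,1), of j]
    by (simp add: tangent_of_def)
qed

lemma subspace_tangent_space: "subspace (tangent_space M p)"
proof (rule subspaceI)
  show "0 \<in> tangent_space M p"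
    by (simp add: tangent_space_def linear_0[OF linear_transition])
  fix v w assume v: "v \<in> tangent_space M p" and w: "w \<in> tangent_space M p"
  show "v + w \<in> tangent_space M p"
    unfolding tangent_space_def mem_Collect_eq plus_fun_apply
    using tangent_spaceD[OF v] tangent_spaceD[OF w] linear_add[OF linear_transition]
    by (metis add_0)
next
  fix c v assume v: "v \<in> tangent_space M p"
  show "c *\<^sub>R v \<in> tangent_space M p"
    unfolding tangent_space_def mem_Collect_eq scaleR_fun_def
    using tangent_spaceD[OF v] linear_scale[OF linear_transition]
    by (metis scaleR_zero_right)
qed

lemma map_tangent_of:
  "i \<in> charts_at M p \<Longrightarrow> set vs \<subseteq> tangent_space M p \<Longrightarrow>
    map (tangent_of M i p) (map (\<lambda>v. v i) vs) = vs"
  by (induction vs) (auto simp: tangent_of_tangent)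

lemma map_tangent_of_component:
  "i \<in> charts_at M p \<Longrightarrow> map (\<lambda>v. v i) (map (tangent_of M i p) ws) = ws"
  by (induction ws) (auto simp: tangent_of_component)

lemma set_map_tangent_of:
  "i \<in> charts_at M p \<Longrightarrow> set (map (tangent_of M i p) ws) \<subseteq> tangent_space M p"
  by (auto simp: tangent_of_mem)

lemma local_rep_chart:
  "i \<in> charts_at M p \<Longrightarrow> local_rep M \<omega> i (chart M i p) ws = \<omega> p (map (tangent_of M i p) ws)"
  by (simp add: local_rep_def charts_at_def chart_inv_chart)

section \<open>Open submanifolds\<close>

text \<open>\<open>chart_inv\<close> is an \<open>inv_into\<close> and so depends on the chart
  domain: after shrinking it, the values off the smaller image are arbitrary. Objects of
  \<open>M\<close> and of the submanifold are thus compared only on that image; for open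
  \<open>V\<close> it is open, which suffices for derivatives.\<close>

lemma chart_inv_submanifold:
  assumes "i \<in> idx M" "p \<in> cdom M i" "p \<in> V"
  shows "chart_inv (open_submanifold M V) i (chart M i p) = p"
proof -
  have "inj_on (chart M i) (cdom M i \<inter> V)"
    using inj_on_chart[OF assms(1)] by (rule inj_on_subset) simp
  then show ?thesis
    using assms by (simp add: chart_inv_def open_submanifold_def)
qed

context
  fixes V :: "'a set"
  assumes V: "openin (mtop M) V"
begin

lemma topspace_submanifold: "topspace (mtop (open_submanifold M V)) = V"
  using openin_subset[OF V] by (auto simp: open_submanifold_def)

lemma transition_submanifold:
  assumes "i \<in> idx M" "x \<in> chart M i ` (cdom M i \<inter> V)"
  shows "transition (open_submanifold M V) i j x = transition M i j x"
  using assms by (auto simp: transition_def chart_inv_submanifold chart_inv_chart)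
    (simp add: open_submanifold_def)

lemma frechet_derivative_transition_submanifold:
  assumes "i \<in> charts_at M p" "p \<in> V"
  shows "frechet_derivative (transition (open_submanifold M V) i j) (at (chart M i p)) =
    frechet_derivative (transition M i j) (at (chart M i p))"
proof -
  have i: "i \<in> idx M" "p \<in> cdom M i" using assms by (auto simp: charts_at_def)
  show ?thesis
    by (rule frechet_derivative_cong_open[OF open_chart_image[OF i(1) V]])
      (use i assms in \<open>auto simp: transition_submanifold\<close>)
qed

lemma chart_submanifold: "chart (open_submanifold M V) = chart M"
  by (simp add: open_submanifold_def)

lemma tangent_space_submanifold:
  "p \<in> V \<Longrightarrow> tangent_space (open_submanifold M V) p = tangent_space M p"
  by (simp add: tangent_space_def charts_at_submanifold chart_submanifold
      frechet_derivative_transition_submanifold)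

lemma tangent_of_submanifold:
  "i \<in> charts_at M p \<Longrightarrow> p \<in> V \<Longrightarrow> tangent_of (open_submanifold M V) i p = tangent_of M i p"
  by (simp add: tangent_of_def charts_at_submanifold chart_submanifold
      frechet_derivative_transition_submanifold fun_eq_iff)

lemma local_rep_submanifold:
  assumes "i \<in> idx M" "x \<in> chart M i ` (cdom M i \<inter> V)" "\<And>p. p \<in> V \<Longrightarrow> \<omega> p = \<omega>' p"
  shows "local_rep (open_submanifold M V) \<omega> i x ws = local_rep M \<omega>' i x ws"
  using assms
  by (auto simp: local_rep_def chart_inv_submanifold chart_inv_chart tangent_of_submanifold charts_atI)

lemma smooth_manifold_submanifold: "smooth_manifold (open_submanifold M V)"
proof -
  let ?N = "open_submanifold M V"
  have sel: "mtop ?N = subtopology (mtop M) V" "idx ?N = idx M"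
    "\<And>i. cdom ?N i = cdom M i \<inter> V" "chart ?N = chart M"
    by (auto simp: open_submanifold_def)
  have "Hausdorff_space (mtop ?N)"
    using M by (simp add: sel smooth_manifold_def Hausdorff_space_subtopology)
  moreover have "second_countable_space (mtop ?N)"
  proof -
    obtain \<B> where \<B>: "countable \<B>" "\<forall>W\<in>\<B>. openin (mtop M) W"
      "\<And>W. openin (mtop M) W \<Longrightarrow> \<exists>\<C>\<subseteq>\<B>. W = \<Union>\<C>"
      using M[unfolded smooth_manifold_def second_countable_space_def, THEN conjunct2, THEN conjunct1]
      by metis
    have "\<exists>\<C>\<subseteq>(\<lambda>W. W \<inter> V) ` \<B>. W = \<Union>\<C>" if W: "openin (mtop ?N) W" for W
    proof -
      obtain W' where W': "openin (mtop M) W'" "W = W' \<inter> V"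
        using W unfolding sel openin_subtopology by blast
      with \<B>(3) obtain \<C> where "\<C> \<subseteq> \<B>" "W' = \<Union>\<C>" by blast
      then show ?thesis
        using W' by (intro exI[of _ "(\<lambda>W. W \<inter> V) ` \<C>"]) auto
    qed
    then show ?thesis
      using \<B>(1,2) unfolding second_countable_space_def
      by (intro exI[of _ "(\<lambda>W. W \<inter> V) ` \<B>"]) (auto simp: sel openin_subtopology)
  qed
  moreover have "(\<Union>i\<in>idx ?N. cdom ?N i) = topspace (mtop ?N)"
    using M by (simp add: sel smooth_manifold_def)
  moreover have "openin (mtop ?N) (cdom ?N i)" "open (chart ?N i ` cdom ?N i)"
    "homeomorphic_map (subtopology (mtop ?N) (cdom ?N i))
        (top_of_set (chart ?N i ` cdom ?N i)) (chart ?N i)" if i: "i \<in> idx ?N" for i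
  proof -
    have i': "i \<in> idx M" using i by (simp add: sel)
    show "openin (mtop ?N) (cdom ?N i)"
      using openin_cdom[OF i'] by (auto simp: sel openin_subtopology)
    show "open (chart ?N i ` cdom ?N i)"
      using open_chart_image[OF i' V] by (simp add: sel)
    have "homeomorphic_map (subtopology (subtopology (mtop M) (cdom M i)) V)
        (subtopology (top_of_set (chart M i ` cdom M i)) (chart M i ` (cdom M i \<inter> V))) (chart M i)"
      by (rule homeomorphic_map_subtopologies[OF chart_homeomorphic[OF i']])
        (use cdom_subset_topspace[OF i'] in auto)
    then show "homeomorphic_map (subtopology (mtop ?N) (cdom ?N i))
        (top_of_set (chart ?N i ` cdom ?N i)) (chart ?N i)"
      by (simp add: sel subtopology_subtopology Int_ac image_mono Int_absorb1)
  qed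
  moreover have "smooth_on (chart ?N i ` (cdom ?N i \<inter> cdom ?N j)) (transition ?N i j)"
    if "i \<in> idx ?N" "j \<in> idx ?N" for i j
  proof -
    have ij: "i \<in> idx M" "j \<in> idx M" using that by (simp_all add: sel)
    have S: "open (chart M i ` (cdom M i \<inter> (cdom M j \<inter> V)))"
      using V openin_cdom[OF ij(2)] by (intro open_chart_image ij openin_Int)
    have "smooth_on (chart M i ` (cdom M i \<inter> (cdom M j \<inter> V))) (transition M i j)"
      using smooth_on_transition[OF ij] by (rule smooth_on_subset) auto
    then have "smooth_on (chart M i ` (cdom M i \<inter> (cdom M j \<inter> V))) (transition ?N i j)"
      by (subst smooth_on_cong[OF S, of _ "transition M i j"])
        (use ij in \<open>auto simp: transition_submanifold\<close>)
    moreover have "cdom ?N i \<inter> cdom ?N j = cdom M i \<inter> (cdom M j \<inter> V)"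
      by (auto simp: sel)
    ultimately show ?thesis by (simp add: sel)
  qed
  ultimately show ?thesis unfolding smooth_manifold_def by blast
qed

text \<open>At a point of \<open>V\<close> the sets \<open>charts_at\<close> of \<open>M\<close> and
  of the submanifold coincide, so \<open>SOME\<close> selects the same chart for both derivatives,
  and a derivative only sees a neighbourhood. Hence no comparison of different charts
  arises.\<close>

lemma restrict_ext_deriv:
  "restrict_form (ext_deriv M \<omega>) V = ext_deriv (open_submanifold M V) (restrict_form \<omega> V)"
proof (intro ext)
  fix p vs
  let ?N = "open_submanifold M V"
  show "restrict_form (ext_deriv M \<omega>) V p vs = ext_deriv ?N (restrict_form \<omega> V) p vs"
  proof (cases "p \<in> V \<and> set vs \<subseteq> tangent_space M p")
    case False
    then show ?thesis
      by (auto simp: ext_deriv_def restrict_form_def topspace_submanifold tangent_space_submanifold)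
  next
    case True
    then have p: "p \<in> topspace (mtop M)" using openin_subset[OF V] by auto
    define i where "i = (SOME i. i \<in> charts_at M p)"
    have "i \<in> charts_at M p"
      unfolding i_def using charts_at_nonempty[OF p] by (rule someI_ex)
    then have i: "i \<in> idx M" "p \<in> cdom M i" by (auto simp: charts_at_def)
    have "local_ext_deriv (local_rep M \<omega> i) (chart M i p) (map (\<lambda>v. v i) vs) =
        local_ext_deriv (local_rep ?N (restrict_form \<omega> V) i) (chart M i p) (map (\<lambda>v. v i) vs)"
      by (rule local_ext_deriv_cong[OF open_chart_image[OF i(1) V]])
        (use True i in \<open>auto simp: local_rep_submanifold[where \<omega>' = \<omega>] restrict_form_def\<close>)
    then show ?thesis
      using True p
      by (simp add: ext_deriv_def restrict_form_def topspace_submanifold tangent_space_submanifold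
          charts_at_submanifold chart_submanifold Let_def flip: i_def)
  qed
qed

lemma restrict_form_mem_forms:
  assumes "\<omega> \<in> forms k M"
  shows "restrict_form \<omega> V \<in> forms k (open_submanifold M V)"
proof -
  let ?N = "open_submanifold M V"
  have sel: "idx ?N = idx M" "\<And>i. cdom ?N i = cdom M i \<inter> V"
    by (auto simp: open_submanifold_def)
  have "smooth_on (chart M i ` (cdom M i \<inter> V)) (\<lambda>x. local_rep ?N (restrict_form \<omega> V) i x ws)"
    if "i \<in> idx M" "length ws = k" for i ws
  proof -
    have "smooth_on (chart M i ` (cdom M i \<inter> V)) (\<lambda>x. local_rep M \<omega> i x ws)"
      by (rule smooth_on_subset[of "chart M i ` cdom M i"])
        (use assms that in \<open>auto simp: forms_def\<close>)
    then show ?thesis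
      by (subst smooth_on_cong[OF open_chart_image[OF that(1) V] local_rep_submanifold])
        (use that in \<open>auto simp: restrict_form_def\<close>)
  qed
  moreover have "restrict_form \<omega> V p \<in> alternating_forms k (tangent_space M p)" if "p \<in> V" for p
    using that assms openin_subset[OF V] by (auto simp: forms_def restrict_form_def)
  ultimately show ?thesis
    unfolding forms_def
    by (auto simp: topspace_submanifold tangent_space_submanifold chart_submanifold sel
        restrict_form_def)
qed

lemma restrict_form_mem_forms_pred:
  "\<omega> \<in> forms_pred k M \<Longrightarrow> restrict_form \<omega> V \<in> forms_pred k (open_submanifold M V)"
  by (cases k) (auto simp: forms_pred_def restrict_form_mem_forms, simp add: restrict_form_def fun_eq_iff)

lemma restrict_form_mem_closed_forms:
  assumes "\<omega> \<in> closed_forms k M"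
  shows "restrict_form \<omega> V \<in> closed_forms k (open_submanifold M V)"
proof -
  have "restrict_form 0 V = (0 :: ('i, 'a, 'e) form)"
    by (simp add: restrict_form_def fun_eq_iff)
  then show ?thesis
    using assms restrict_form_mem_forms by (auto simp: closed_forms_def simp flip: restrict_ext_deriv)
qed

lemma restrict_form_mem_exact_forms:
  "\<omega> \<in> exact_forms k M \<Longrightarrow> restrict_form \<omega> V \<in> exact_forms k (open_submanifold M V)"
  unfolding exact_forms_def using restrict_ext_deriv restrict_form_mem_forms_pred by auto

end

end

section \<open>Forms and locality\<close>

lemma formsD:
  assumes "\<omega> \<in> forms k M"
  shows "p \<in> topspace (mtop M) \<Longrightarrow> \<omega> p \<in> alternating_forms k (tangent_space M p)"
    and "p \<notin> topspace (mtop M) \<Longrightarrow> \<omega> p = 0"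
    and "i \<in> idx M \<Longrightarrow> length ws = k \<Longrightarrow>
      smooth_on (chart M i ` cdom M i) (\<lambda>x. local_rep M \<omega> i x ws)"
  using assms unfolding forms_def by auto

lemma ext_deriv_outside: "\<not> (p \<in> topspace (mtop M) \<and> set vs \<subseteq> tangent_space M p) \<Longrightarrow> ext_deriv M \<omega> p vs = 0"
  by (auto simp: ext_deriv_def)

context
  fixes M :: "('i, 'a, 'e::{real_inner,heine_borel}) manifold"
  assumes M: "smooth_manifold M"
begin

text \<open>Sheaf property: being alternating is a condition at each point, and smoothness in a
  chart is local by \<open>smooth_on_local\<close>.\<close>

lemma forms_local:
  assumes loc: "\<And>p. p \<in> topspace (mtop M) \<Longrightarrow>
      \<exists>V. openin (mtop M) V \<and> p \<in> V \<and> restrict_form \<omega> V \<in> forms k (open_submanifold M V)"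
    and outside: "\<And>p. p \<notin> topspace (mtop M) \<Longrightarrow> \<omega> p = 0"
  shows "\<omega> \<in> forms k M"
  unfolding forms_def mem_Collect_eq
proof (intro conjI ballI allI impI)
  fix p assume "p \<in> topspace (mtop M)"
  then obtain V where V: "openin (mtop M) V" "p \<in> V" "restrict_form \<omega> V \<in> forms k (open_submanifold M V)"
    using loc by blast
  then have "restrict_form \<omega> V p \<in> alternating_forms k (tangent_space (open_submanifold M V) p)"
    by (auto simp: forms_def topspace_submanifold[OF M])
  then show "\<omega> p \<in> alternating_forms k (tangent_space M p)"
    using V by (simp add: tangent_space_submanifold[OF M] restrict_form_def)
next
  fix i and ws :: "'e list" assume i: "i \<in> idx M" and ws: "length ws = k"
  show "smooth_on (chart M i ` cdom M i) (\<lambda>x. local_rep M \<omega> i x ws)"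
  proof (rule smooth_on_local)
    fix x assume "x \<in> chart M i ` cdom M i"
    then obtain p where p: "p \<in> cdom M i" "x = chart M i p" by blast
    then obtain V where V: "openin (mtop M) V" "p \<in> V"
      "restrict_form \<omega> V \<in> forms k (open_submanifold M V)"
      using loc cdom_subset_topspace[OF M i] by blast
    let ?S = "chart M i ` (cdom M i \<inter> V)"
    have S: "open ?S" by (rule open_chart_image[OF M i V(1)])
    have "smooth_on ?S (\<lambda>x. local_rep (open_submanifold M V) (restrict_form \<omega> V) i x ws)"
      using V(3) i ws unfolding forms_def by (auto simp: open_submanifold_def)
    then have "smooth_on ?S (\<lambda>x. local_rep M \<omega> i x ws)"
      by (subst smooth_on_cong[OF S local_rep_submanifold[OF M V(1) i, symmetric]])
        (auto simp: restrict_form_def)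
    then show "\<exists>T. open T \<and> x \<in> T \<and> smooth_on T (\<lambda>x. local_rep M \<omega> i x ws)"
      using S p V by blast
  qed
qed (use outside in auto)

lemma closed_forms_local:
  assumes loc: "\<And>p. p \<in> topspace (mtop M) \<Longrightarrow>
      \<exists>V. openin (mtop M) V \<and> p \<in> V \<and> restrict_form \<omega> V \<in> closed_forms k (open_submanifold M V)"
    and outside: "\<And>p. p \<notin> topspace (mtop M) \<Longrightarrow> \<omega> p = 0"
  shows "\<omega> \<in> closed_forms k M"
proof -
  have "\<omega> \<in> forms k M"
    by (rule forms_local[OF _ outside]) (use loc in \<open>auto simp: closed_forms_def\<close>)
  moreover have "ext_deriv M \<omega> p = 0" for p
  proof (cases "p \<in> topspace (mtop M)")
    case True
    then obtain V where V: "openin (mtop M) V" "p \<in> V"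
      "restrict_form \<omega> V \<in> closed_forms k (open_submanifold M V)"
      using loc by blast
    then have "restrict_form (ext_deriv M \<omega>) V p = 0"
      by (simp add: restrict_ext_deriv[OF M] closed_forms_def)
    then show ?thesis using V(2) by (simp add: restrict_form_def)
  qed (simp add: ext_deriv_def fun_eq_iff)
  ultimately show ?thesis by (simp add: closed_forms_def fun_eq_iff)
qed

lemma local_rep_differentiable:
  assumes "\<omega> \<in> forms k M" "i \<in> charts_at M p" "length ws = k"
  shows "(\<lambda>x. local_rep M \<omega> i x ws) differentiable (at (chart M i p))"
  by (rule smooth_on_imp_differentiable[OF formsD(3)[OF assms(1)]])
    (use assms in \<open>auto simp: charts_at_def\<close>)

text \<open>The chart is fixed before \<open>\<omega>\<close> and \<open>vs\<close>, so identities
  between derivatives of several forms can be checked in one common chart.\<close>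

lemma ext_deriv_chart:
  assumes "p \<in> topspace (mtop M)"
  obtains i where "i \<in> charts_at M p"
    "\<And>\<omega> vs. set vs \<subseteq> tangent_space M p \<Longrightarrow>
      ext_deriv M \<omega> p vs = local_ext_deriv (local_rep M \<omega> i) (chart M i p) (map (\<lambda>v. v i) vs)"
proof
  show "(SOME i. i \<in> charts_at M p) \<in> charts_at M p"
    using charts_at_nonempty[OF M assms] by (rule someI_ex)
qed (use assms in \<open>simp add: ext_deriv_def Let_def\<close>)

text \<open>\<open>ext_deriv\<close> does not test the length of its argument list. For a wrong
  positive length the coordinate expression is identically zero on the chart, by the default value
  of alternating forms; the empty list gives an empty sum.\<close>

lemma ext_deriv_length:
  assumes "\<omega> \<in> forms k M" "length vs \<noteq> Suc k"
  shows "ext_deriv M \<omega> p vs = 0"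
proof (cases "p \<in> topspace (mtop M) \<and> set vs \<subseteq> tangent_space M p")
  case True
  then obtain i where i: "i \<in> charts_at M p"
    "ext_deriv M \<omega> p vs = local_ext_deriv (local_rep M \<omega> i) (chart M i p) (map (\<lambda>v. v i) vs)"
    using ext_deriv_chart by metis
  have idx: "i \<in> idx M" "p \<in> cdom M i" using i by (auto simp: charts_at_def)
  show ?thesis
  proof (cases vs)
    case (Cons v us)
    have "local_rep M \<omega> i x ws = 0" if x: "x \<in> chart M i ` cdom M i" and ws: "length ws = length us" for x ws
    proof -
      obtain q where q: "q \<in> cdom M i" "x = chart M i q" using x by blast
      then show ?thesis
        using assms Cons ws idx cdom_subset_topspace[OF M idx(1)]
          alternating_formsD(1)[OF formsD(1)[OF assms(1), of q], of "map (tangent_of M i q) ws"]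
        by (auto simp: local_rep_chart[OF M charts_atI[OF idx(1)]])
    qed
    then have "local_ext_deriv (local_rep M \<omega> i) (chart M i p) (map (\<lambda>v. v i) vs) =
      local_ext_deriv (\<lambda>_ _. 0) (chart M i p) (map (\<lambda>v. v i) vs)"
      by (intro local_ext_deriv_cong[OF open_chart_range[OF M idx(1)]]) (use Cons idx in auto)
    then show ?thesis using i(2) by (simp add: local_ext_deriv_def)
  qed (use i in \<open>simp add: local_ext_deriv_def\<close>)
qed (rule ext_deriv_outside)

section \<open>Linearity of the exterior derivative\<close>

lemma subspace_forms: "subspace (forms k M)"
proof (rule subspaceI)
  show "0 \<in> forms k M"
    using subspace_0[OF subspace_alternating_forms]
    by (auto simp: forms_def local_rep_def smooth_on_const)
next
  fix \<omega> \<eta> assume *: "\<omega> \<in> forms k M" "\<eta> \<in> forms k M"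
  show "\<omega> + \<eta> \<in> forms k M"
    unfolding forms_def mem_Collect_eq
  proof (intro conjI ballI allI impI)
    show "(\<omega> + \<eta>) p \<in> alternating_forms k (tangent_space M p)" if "p \<in> topspace (mtop M)" for p
      unfolding plus_fun_apply[of \<omega>]
      by (intro subspace_add[OF subspace_alternating_forms] formsD *) (rule that)+
    show "(\<omega> + \<eta>) p = 0" if "p \<notin> topspace (mtop M)" for p
      using that * by (simp add: formsD(2) fun_eq_iff)
    show "smooth_on (chart M i ` cdom M i) (\<lambda>x. local_rep M (\<omega> + \<eta>) i x ws)"
      if "i \<in> idx M" "length ws = k" for i ws
      using smooth_on_add[OF open_chart_range[OF M that(1)] formsD(3)[OF *(1) that] formsD(3)[OF *(2) that]]
      by (simp add: local_rep_def)
  qed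
next
  fix c \<omega> assume *: "\<omega> \<in> forms k M"
  show "c *\<^sub>R \<omega> \<in> forms k M"
    unfolding forms_def mem_Collect_eq local_rep_def scaleR_fun_def real_scaleR_def
    by (intro conjI ballI allI impI smooth_on_mult smooth_on_const
        subspace_scale[OF subspace_alternating_forms, unfolded scaleR_fun_def real_scaleR_def]
        open_chart_range[OF M] formsD[OF *, unfolded local_rep_def])
      (simp_all add: formsD[OF *] fun_eq_iff)
qed

lemma ext_deriv_add:
  assumes "\<omega> \<in> forms k M" "\<eta> \<in> forms k M"
  shows "ext_deriv M (\<omega> + \<eta>) = ext_deriv M \<omega> + ext_deriv M \<eta>"
proof (intro ext)
  fix p vs
  show "ext_deriv M (\<omega> + \<eta>) p vs = (ext_deriv M \<omega> + ext_deriv M \<eta>) p vs"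
  proof (cases "length vs = Suc k \<and> p \<in> topspace (mtop M) \<and> set vs \<subseteq> tangent_space M p")
    case True
    obtain i where i: "i \<in> charts_at M p" "\<And>\<omega>. ext_deriv M \<omega> p vs =
        local_ext_deriv (local_rep M \<omega> i) (chart M i p) (map (\<lambda>v. v i) vs)"
      using True ext_deriv_chart by metis
    have "local_rep M (\<omega> + \<eta>) i = (\<lambda>x us. local_rep M \<omega> i x us + local_rep M \<eta> i x us)"
      by (simp add: local_rep_def fun_eq_iff)
    then show ?thesis
      using True unfolding plus_fun_apply i(2)
      by (simp only:) (rule local_ext_deriv_add; rule local_rep_differentiable[OF _ i(1)]; simp add: assms)
  next
    case False
    then show ?thesis
      using ext_deriv_length[OF assms(1)] ext_deriv_length[OF assms(2)]
        ext_deriv_length[OF subspace_add[OF subspace_forms assms]]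
      by (cases "length vs = Suc k") (simp_all add: ext_deriv_outside)
  qed
qed

lemma ext_deriv_scaleR:
  assumes "\<omega> \<in> forms k M"
  shows "ext_deriv M (c *\<^sub>R \<omega>) = c *\<^sub>R ext_deriv M \<omega>"
proof (intro ext)
  fix p vs
  show "ext_deriv M (c *\<^sub>R \<omega>) p vs = (c *\<^sub>R ext_deriv M \<omega>) p vs"
  proof (cases "length vs = Suc k \<and> p \<in> topspace (mtop M) \<and> set vs \<subseteq> tangent_space M p")
    case True
    obtain i where i: "i \<in> charts_at M p" "\<And>\<omega>. ext_deriv M \<omega> p vs =
        local_ext_deriv (local_rep M \<omega> i) (chart M i p) (map (\<lambda>v. v i) vs)"
      using True ext_deriv_chart by metis
    have "local_rep M (c *\<^sub>R \<omega>) i = (\<lambda>x us. c * local_rep M \<omega> i x us)"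
      by (simp add: local_rep_def scaleR_fun_def fun_eq_iff)
    \<comment> \<open>The Leibniz rule for a constant function, whose differential vanishes.\<close>
    moreover have "local_ext_deriv (\<lambda>x us. c * local_rep M \<omega> i x us) (chart M i p) (map (\<lambda>v. v i) vs) =
        c * local_ext_deriv (local_rep M \<omega> i) (chart M i p) (map (\<lambda>v. v i) vs) +
        wedge1 (frechet_derivative (\<lambda>_. c) (at (chart M i p))) (local_rep M \<omega> i (chart M i p)) (map (\<lambda>v. v i) vs)"
      by (rule local_ext_deriv_mult[OF differentiable_const local_rep_differentiable[OF assms i(1)]])
        (use True in simp)
    ultimately show ?thesis
      by (simp add: i(2) wedge1_def scaleR_fun_def)
  next
    case False
    then show ?thesis
      using ext_deriv_length[OF assms] ext_deriv_length[OF subspace_scale[OF subspace_forms assms]]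
      by (cases "length vs = Suc k") (simp_all add: ext_deriv_outside scaleR_fun_def)
  qed
qed

lemma ext_deriv_zero: "ext_deriv M 0 = 0"
  using ext_deriv_scaleR[OF subspace_0[OF subspace_forms], of 0] by simp

lemma subspace_forms_pred: "subspace (forms_pred k M)"
  by (cases k) (auto simp: forms_pred_def subspace_forms)

lemma ext_deriv_linear_forms_pred:
  assumes "\<omega> \<in> forms_pred k M" "\<eta> \<in> forms_pred k M"
  shows "ext_deriv M (\<omega> + \<eta>) = ext_deriv M \<omega> + ext_deriv M \<eta>"
    and "ext_deriv M (c *\<^sub>R \<omega>) = c *\<^sub>R ext_deriv M \<omega>"
  using assms ext_deriv_add ext_deriv_scaleR ext_deriv_zero
  by (auto simp: forms_pred_def split: nat.splits)

lemma subspace_exact_forms: "subspace (exact_forms k M)"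
  unfolding exact_forms_def
proof (rule subspaceI)
  show "0 \<in> ext_deriv M ` forms_pred k M"
    using subspace_0[OF subspace_forms_pred] ext_deriv_zero by (metis image_eqI)
  fix \<omega> \<eta> assume "\<omega> \<in> ext_deriv M ` forms_pred k M" "\<eta> \<in> ext_deriv M ` forms_pred k M"
  then obtain \<mu> \<nu> where "\<mu> \<in> forms_pred k M" "\<nu> \<in> forms_pred k M"
    "\<omega> = ext_deriv M \<mu>" "\<eta> = ext_deriv M \<nu>" by blast
  then show "\<omega> + \<eta> \<in> ext_deriv M ` forms_pred k M"
    using subspace_add[OF subspace_forms_pred] ext_deriv_linear_forms_pred(1) by (metis image_eqI)
next
  fix c \<omega> assume "\<omega> \<in> ext_deriv M ` forms_pred k M"
  then obtain \<mu> where "\<mu> \<in> forms_pred k M" "\<omega> = ext_deriv M \<mu>" by blast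
  then show "c *\<^sub>R \<omega> \<in> ext_deriv M ` forms_pred k M"
    using subspace_scale[OF subspace_forms_pred] ext_deriv_linear_forms_pred(2) by (metis image_eqI)
qed

end

section \<open>Multiplying a form by a smooth function\<close>

definition smooth_fun :: "('i, 'a, 'e::{real_inner,heine_borel}) manifold \<Rightarrow> ('a \<Rightarrow> real) \<Rightarrow> bool"
  where "smooth_fun M \<phi> \<longleftrightarrow> (\<forall>i\<in>idx M. smooth_on (chart M i ` cdom M i) (\<phi> \<circ> chart_inv M i))"

definition scale_form :: "('a \<Rightarrow> real) \<Rightarrow> ('i, 'a, 'e) form \<Rightarrow> ('i, 'a, 'e) form"
  where "scale_form \<phi> \<omega> = (\<lambda>p. \<phi> p *\<^sub>R \<omega> p)"

lemma local_rep_scale_form: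
  "local_rep M (scale_form \<phi> \<omega>) i = (\<lambda>x ws. (\<phi> \<circ> chart_inv M i) x * local_rep M \<omega> i x ws)"
  by (simp add: local_rep_def scale_form_def scaleR_fun_def fun_eq_iff)

lemma wedge1_map: "wedge1 \<alpha> \<beta> (map f vs) = wedge1 (\<lambda>v. \<alpha> (f v)) (\<lambda>us. \<beta> (map f us)) vs"
  by (simp add: wedge1_def map_remove_nth)

context
  fixes M :: "('i, 'a, 'e::{real_inner,heine_borel}) manifold" and \<phi> :: "'a \<Rightarrow> real"
  assumes M: "smooth_manifold M" and \<phi>: "smooth_fun M \<phi>"
begin

lemma smooth_fun_differentiable:
  assumes "i \<in> charts_at M p"
  shows "(\<phi> \<circ> chart_inv M i) differentiable (at (chart M i p))"
  by (rule smooth_on_imp_differentiable[of "chart M i ` cdom M i"])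
    (use \<phi> assms in \<open>auto simp: smooth_fun_def charts_at_def\<close>)

lemma scale_form_mem_forms:
  assumes "\<omega> \<in> forms k M"
  shows "scale_form \<phi> \<omega> \<in> forms k M"
  unfolding forms_def mem_Collect_eq
proof (intro conjI ballI allI impI)
  show "scale_form \<phi> \<omega> p \<in> alternating_forms k (tangent_space M p)" if "p \<in> topspace (mtop M)" for p
    unfolding scale_form_def
    using formsD(1)[OF assms that] by (rule subspace_scale[OF subspace_alternating_forms])
  show "scale_form \<phi> \<omega> p = 0" if "p \<notin> topspace (mtop M)" for p
    using formsD(2)[OF assms that] by (simp add: scale_form_def)
  show "smooth_on (chart M i ` cdom M i) (\<lambda>x. local_rep M (scale_form \<phi> \<omega>) i x ws)"
    if "i \<in> idx M" "length ws = k" for i ws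
    unfolding local_rep_scale_form
    by (intro smooth_on_mult open_chart_range[OF M] formsD(3)[OF assms] that)
      (use \<phi> that in \<open>simp add: smooth_fun_def del: o_apply\<close>)
qed

text \<open>\<open>ext_deriv\<close> works in some selected chart \<open>j\<close>, while
  \<open>i\<close> is arbitrary. The selection stays hidden inside \<open>ext_deriv M \<nu>\<close>;
  only the differential of \<open>\<phi>\<close> has to be carried from \<open>j\<close> to
  \<open>i\<close>, by \<open>frechet_derivative_change_chart\<close>.\<close>

lemma ext_deriv_scale_form:
  assumes \<nu>: "\<nu> \<in> forms m M" and i: "i \<in> charts_at M p"
    and vs: "length vs = Suc m" "set vs \<subseteq> tangent_space M p"
  shows "ext_deriv M (scale_form \<phi> \<nu>) p vs = \<phi> p * ext_deriv M \<nu> p vs +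
    wedge1 (\<lambda>v. frechet_derivative (\<phi> \<circ> chart_inv M i) (at (chart M i p)) (v i)) (\<nu> p) vs"
proof -
  have "p \<in> topspace (mtop M)"
    using i cdom_subset_topspace[OF M] by (auto simp: charts_at_def)
  then obtain j where j: "j \<in> charts_at M p" "\<And>\<omega>. ext_deriv M \<omega> p vs =
      local_ext_deriv (local_rep M \<omega> j) (chart M j p) (map (\<lambda>v. v j) vs)"
    using ext_deriv_chart[OF M] vs(2) by metis
  have "ext_deriv M (scale_form \<phi> \<nu>) p vs =
      (\<phi> \<circ> chart_inv M j) (chart M j p) * ext_deriv M \<nu> p vs +
      wedge1 (frechet_derivative (\<phi> \<circ> chart_inv M j) (at (chart M j p)))
        (local_rep M \<nu> j (chart M j p)) (map (\<lambda>v. v j) vs)"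
    unfolding j(2) local_rep_scale_form
    by (rule local_ext_deriv_mult[OF smooth_fun_differentiable[OF j(1)]
          local_rep_differentiable[OF M \<nu> j(1)]]) (use vs in simp)
  also have "(\<phi> \<circ> chart_inv M j) (chart M j p) = \<phi> p"
    using j(1) by (simp add: charts_at_def chart_inv_chart[OF M])
  also have "wedge1 (frechet_derivative (\<phi> \<circ> chart_inv M j) (at (chart M j p)))
        (local_rep M \<nu> j (chart M j p)) (map (\<lambda>v. v j) vs) =
      wedge1 (\<lambda>v. frechet_derivative (\<phi> \<circ> chart_inv M i) (at (chart M i p)) (v i)) (\<nu> p) vs"
    unfolding wedge1_map unfolding wedge1_def
  proof (rule sum.cong, goal_cases)
    case (2 l)
    have sub: "set (remove_nth l vs) \<subseteq> tangent_space M p"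
      using set_remove_nth vs(2) by fast
    have "vs ! l \<in> tangent_space M p" using 2 vs(2) by auto
    then have "(vs ! l) j = frechet_derivative (transition M i j) (at (chart M i p)) ((vs ! l) i)"
      by (rule tangent_spaceD(2)[OF M _ i j(1)])
    then show ?case
      using frechet_derivative_change_chart[OF M i j(1) smooth_fun_differentiable[OF j(1)]]
        local_rep_chart[OF M j(1)] map_tangent_of[OF M j(1) sub] by simp
  qed simp
  finally show ?thesis .
qed

text \<open>This is \<open>ext_deriv_scale_form\<close> read in one fixed chart over its whole
  domain. It reduces smoothness of \<open>d(\<phi>\<nu>)\<close> to that of \<open>d\<nu>\<close>,
  all other ingredients being visibly smooth.\<close>

lemma local_rep_ext_deriv_scale_form:
  assumes \<nu>: "\<nu> \<in> forms m M" and i: "i \<in> idx M" "x \<in> chart M i ` cdom M i" and ws: "length ws = Suc m"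
  shows "local_rep M (ext_deriv M (scale_form \<phi> \<nu>)) i x ws =
    (\<phi> \<circ> chart_inv M i) x * local_rep M (ext_deriv M \<nu>) i x ws +
    wedge1 (frechet_derivative (\<phi> \<circ> chart_inv M i) (at x)) (local_rep M \<nu> i x) ws"
proof -
  obtain p where p: "p \<in> cdom M i" "x = chart M i p" using i(2) by blast
  then have ip: "i \<in> charts_at M p" by (intro charts_atI i(1))
  have "local_rep M \<nu> i (chart M i p) = (\<lambda>us. \<nu> p (map (tangent_of M i p) us))"
    using local_rep_chart[OF M ip] by blast
  then show ?thesis
    using ext_deriv_scale_form[OF \<nu> ip, of "map (tangent_of M i p) ws"] ws
      set_map_tangent_of[OF M ip, of ws]
    by (simp add: p(2) local_rep_chart[OF M ip] chart_inv_chart[OF M i(1) p(1)] wedge1_map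
        tangent_of_component[OF M ip])
qed

text \<open>Differentiating \<open>\<phi> d\<nu> + d\<phi> \<and> \<nu>\<close> gives \<open>\<phi>
  d d\<nu> + d\<phi> \<and> d\<nu> - d\<phi> \<and> d\<nu>\<close>. The hypothesis on
  \<open>d\<nu>\<close> supplies both its smoothness and \<open>d d\<nu> = 0\<close>.\<close>

lemma ext_deriv_scale_form_closed:
  assumes \<nu>: "\<nu> \<in> forms m M" and d\<nu>: "ext_deriv M \<nu> \<in> closed_forms (Suc m) M"
  shows "ext_deriv M (scale_form \<phi> \<nu>) \<in> closed_forms (Suc m) M"
proof -
  let ?\<theta> = "ext_deriv M \<nu>" and ?\<rho> = "ext_deriv M (scale_form \<phi> \<nu>)"
  have \<theta>: "?\<theta> \<in> forms (Suc m) M" using d\<nu> by (simp add: closed_forms_def)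
  have "?\<rho> \<in> forms (Suc m) M"
    unfolding forms_def mem_Collect_eq
  proof (intro conjI ballI allI impI)
    fix p assume p: "p \<in> topspace (mtop M)"
    let ?V = "tangent_space M p"
    obtain i where i: "i \<in> charts_at M p" using charts_at_nonempty[OF M p] by blast
    let ?\<alpha> = "\<lambda>v. frechet_derivative (\<phi> \<circ> chart_inv M i) (at (chart M i p)) (v i)"
    have lin: "linear (frechet_derivative (\<phi> \<circ> chart_inv M i) (at (chart M i p)))"
      by (rule linear_frechet_derivative[OF smooth_fun_differentiable[OF i]])
    \<comment> \<open>\<open>wedge1\<close> carries no default value, so it is set to zero off lists
      of the right length in the tangent space before it can be an alternating form.\<close>
    have "(\<lambda>vs. if length vs = Suc m \<and> set vs \<subseteq> ?V then wedge1 ?\<alpha> (\<nu> p) vs else 0)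
        \<in> alternating_forms (Suc m) ?V" (is "?w \<in> _")
      by (rule wedge1_alternating[OF formsD(1)[OF \<nu> p] subspace_tangent_space[OF M]])
        (simp_all add: linear_add[OF lin] linear_scale[OF lin] scaleR_fun_def)
    then have "\<phi> p *\<^sub>R ?\<theta> p + ?w \<in> alternating_forms (Suc m) ?V"
      by (intro subspace_add[OF subspace_alternating_forms]
          subspace_scale[OF subspace_alternating_forms] formsD(1)[OF \<theta> p])
    moreover have "?\<rho> p = \<phi> p *\<^sub>R ?\<theta> p + ?w"
    proof
      fix vs
      show "?\<rho> p vs = (\<phi> p *\<^sub>R ?\<theta> p + ?w) vs"
        using ext_deriv_scale_form[OF \<nu> i, of vs] ext_deriv_length[OF M scale_form_mem_forms[OF \<nu>], of vs p]
          ext_deriv_length[OF M \<nu>, of vs p] ext_deriv_outside[of p M vs]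
        by (cases "length vs = Suc m") (auto simp: scaleR_fun_def)
    qed
    ultimately show "?\<rho> p \<in> alternating_forms (Suc m) ?V" by simp
  next
    fix p assume "p \<notin> topspace (mtop M)"
    then show "?\<rho> p = 0" by (simp add: ext_deriv_def fun_eq_iff)
  next
    fix i and ws :: "'e list" assume i: "i \<in> idx M" and ws: "length ws = Suc m"
    let ?S = "chart M i ` cdom M i"
    have S: "open ?S" by (rule open_chart_range[OF M i])
    have \<phi>': "smooth_on ?S (\<phi> \<circ> chart_inv M i)" using \<phi> i by (simp add: smooth_fun_def)
    have "smooth_on ?S (\<lambda>x. (\<phi> \<circ> chart_inv M i) x * local_rep M ?\<theta> i x ws +
        wedge1 (frechet_derivative (\<phi> \<circ> chart_inv M i) (at x)) (local_rep M \<nu> i x) ws)"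
      unfolding wedge1_def
      by (intro smooth_on_add smooth_on_mult smooth_on_sum smooth_on_const \<phi>' S
          smooth_on_frechet_derivative formsD(3)[OF \<theta>] formsD(3)[OF \<nu>] i ws)
        (use ws in \<open>simp add: length_remove_nth\<close>)
    then show "smooth_on ?S (\<lambda>x. local_rep M ?\<rho> i x ws)"
      using smooth_on_cong[OF S local_rep_ext_deriv_scale_form[OF \<nu> i _ ws]] by simp
  qed
  moreover have "ext_deriv M ?\<rho> p vs = 0" for p vs
  proof (cases "length vs = m + 2 \<and> p \<in> topspace (mtop M) \<and> set vs \<subseteq> tangent_space M p")
    case False
    then show ?thesis
      using ext_deriv_length[OF M calculation, of vs p] by (auto intro: ext_deriv_outside)
  next
    case True
    then obtain i where ip: "i \<in> charts_at M p" and d: "\<And>\<omega> vs. set vs \<subseteq> tangent_space M p \<Longrightarrow>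
        ext_deriv M \<omega> p vs = local_ext_deriv (local_rep M \<omega> i) (chart M i p) (map (\<lambda>v. v i) vs)"
      using ext_deriv_chart[OF M] by metis
    then have i: "i \<in> idx M" "p \<in> cdom M i" by (auto simp: charts_at_def)
    let ?S = "chart M i ` cdom M i" and ?x = "chart M i p" and ?ws = "map (\<lambda>v. v i) vs"
    let ?f = "\<phi> \<circ> chart_inv M i" and ?\<eta> = "local_rep M \<nu> i" and ?\<tau> = "local_rep M ?\<theta> i"
    have S: "open ?S" "?x \<in> ?S" using open_chart_range[OF M i(1)] i by auto
    have f: "smooth_on ?S ?f" using \<phi> i by (simp add: smooth_fun_def)
    have len: "length ?ws = m + 2" using True by simp
    have \<tau>: "(\<lambda>y. ?\<tau> y us) differentiable (at ?x)" if "length us = Suc m" for us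
      using that by (rule local_rep_differentiable[OF M \<theta> ip])
    have \<eta>: "(\<lambda>y. ?\<eta> y us) differentiable (at ?x)" if "length us = m" for us
      using that by (rule local_rep_differentiable[OF M \<nu> ip])
    have wedge: "(\<lambda>y. wedge1 (frechet_derivative ?f (at y)) (?\<eta> y) us) differentiable (at ?x)"
      if "length us = Suc m" for us
    proof (rule smooth_on_imp_differentiable[OF _ S(2)])
      show "smooth_on ?S (\<lambda>y. wedge1 (frechet_derivative ?f (at y)) (?\<eta> y) us)"
        unfolding wedge1_def
        by (intro smooth_on_mult smooth_on_sum smooth_on_const S(1)
            smooth_on_frechet_derivative f formsD(3)[OF \<nu>] i)
          (use that in \<open>simp add: length_remove_nth\<close>)
    qed
    \<comment> \<open>This holds at the point \<open>?x\<close> because \<open>ext_deriv\<close> is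
      computed in chart \<open>i\<close> at \<open>p\<close>; at neighbouring points another chart
      may be selected. The identity is applied only after all derivatives have been taken.\<close>
    have "?\<tau> ?x us = local_ext_deriv ?\<eta> ?x us" for us
      using d[OF set_map_tangent_of[OF M ip], of \<nu> us]
      by (simp only: local_rep_chart[OF M ip] map_tangent_of_component[OF M ip])
    then have \<tau>_eq: "?\<tau> ?x = local_ext_deriv ?\<eta> ?x" by blast
    have "ext_deriv M ?\<theta> p vs = 0"
      using d\<nu> by (simp add: closed_forms_def)
    then have \<tau>_closed: "local_ext_deriv ?\<tau> ?x ?ws = 0" using d True by simp
    have "ext_deriv M ?\<rho> p vs = local_ext_deriv (local_rep M ?\<rho> i) ?x ?ws"
      using d True by simp
    also have "\<dots> = local_ext_deriv (\<lambda>y us. ?f y * ?\<tau> y us +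
        wedge1 (frechet_derivative ?f (at y)) (?\<eta> y) us) ?x ?ws"
      by (rule local_ext_deriv_cong[OF S])
        (use local_rep_ext_deriv_scale_form[OF \<nu> i(1)] len in simp)
    also have "\<dots> = local_ext_deriv (\<lambda>y us. ?f y * ?\<tau> y us) ?x ?ws +
        local_ext_deriv (\<lambda>y. wedge1 (frechet_derivative ?f (at y)) (?\<eta> y)) ?x ?ws"
      by (rule local_ext_deriv_add)
        (use len \<tau> wedge smooth_on_imp_differentiable[OF f S(2)] in \<open>auto intro!: differentiable_mult simp del: o_apply\<close>)
    also have "local_ext_deriv (\<lambda>y us. ?f y * ?\<tau> y us) ?x ?ws =
        ?f ?x * local_ext_deriv ?\<tau> ?x ?ws + wedge1 (frechet_derivative ?f (at ?x)) (?\<tau> ?x) ?ws"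
      by (rule local_ext_deriv_mult)
        (use len \<tau> smooth_on_imp_differentiable[OF f S(2)] in \<open>auto simp del: o_apply\<close>)
    also have "local_ext_deriv (\<lambda>y. wedge1 (frechet_derivative ?f (at y)) (?\<eta> y)) ?x ?ws =
        - wedge1 (frechet_derivative ?f (at ?x)) (local_ext_deriv ?\<eta> ?x) ?ws"
      by (rule local_ext_deriv_wedge1[OF S f \<eta> len])
    finally show ?thesis by (simp add: \<tau>_closed \<tau>_eq del: o_apply)
  qed
  ultimately show ?thesis by (simp add: closed_forms_def fun_eq_iff)
qed

end

section \<open>Bump functions\<close>

lemma smooth_fun_const: "smooth_fun M (\<lambda>_. c)"
  by (simp add: smooth_fun_def o_def smooth_on_const)

lemma zero_mem_closed_forms: "smooth_manifold M \<Longrightarrow> 0 \<in> closed_forms k M"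
  by (simp add: closed_forms_def subspace_0[OF subspace_forms] ext_deriv_zero)

lemma linear_restrict_form: "linear (\<lambda>\<omega>. restrict_form \<omega> V)"
  by (rule linearI) (auto simp: restrict_form_def scaleR_fun_def fun_eq_iff)

context
  fixes M :: "('i, 'a, 'e::{real_inner,heine_borel}) manifold"
  assumes M: "smooth_manifold M"
begin

lemma smooth_fun_diff: "smooth_fun M \<phi> \<Longrightarrow> smooth_fun M \<psi> \<Longrightarrow> smooth_fun M (\<lambda>p. \<phi> p - \<psi> p)"
  unfolding smooth_fun_def o_def by (auto intro: smooth_on_diff open_chart_range[OF M])

lemma smooth_fun_mult: "smooth_fun M \<phi> \<Longrightarrow> smooth_fun M \<psi> \<Longrightarrow> smooth_fun M (\<lambda>p. \<phi> p * \<psi> p)"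
  unfolding smooth_fun_def o_def by (auto intro: smooth_on_mult open_chart_range[OF M])

lemma smooth_fun_prod:
  "(\<And>i. i \<in> I \<Longrightarrow> smooth_fun M (\<phi> i)) \<Longrightarrow> smooth_fun M (\<lambda>p. \<Prod>i\<in>I. \<phi> i p)"
  by (induction I rule: infinite_finite_induct) (simp_all add: smooth_fun_const smooth_fun_mult)

lemma smooth_fun_submanifold:
  assumes V: "openin (mtop M) V" and \<phi>: "smooth_fun M \<phi>"
  shows "smooth_fun (open_submanifold M V) \<phi>"
proof -
  have "smooth_on (chart M i ` (cdom M i \<inter> V)) (\<phi> \<circ> chart_inv (open_submanifold M V) i)"
    if i: "i \<in> idx M" for i
  proof -
    have "smooth_on (chart M i ` (cdom M i \<inter> V)) (\<phi> \<circ> chart_inv M i)"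
      by (rule smooth_on_subset[of "chart M i ` cdom M i"]) (use \<phi> i in \<open>auto simp: smooth_fun_def\<close>)
    then show ?thesis
      by (subst smooth_on_cong[OF open_chart_image[OF M i V], of _ "\<phi> \<circ> chart_inv M i"])
        (use i in \<open>auto simp: chart_inv_submanifold[OF M] chart_inv_chart[OF M]\<close>)
  qed
  then show ?thesis by (simp add: smooth_fun_def) (simp add: open_submanifold_def)
qed

text \<open>A cut-off of one variable is applied to the squared distance from \<open>p\<close> in a
  chart, the square being an inner product and hence smooth. Extension by zero stays smooth because
  the compact set \<open>L\<close> is closed in a Hausdorff space, so each point outside the chart
  domain has a neighbourhood that misses \<open>L\<close>.\<close>

lemma bump_function_at_point:
  assumes p: "p \<in> topspace (mtop M)"
  obtains \<phi> W L where "smooth_fun M \<phi>" "openin (mtop M) W" "p \<in> W" "\<And>q. q \<in> W \<Longrightarrow> \<phi> q = 1"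
    "compactin (mtop M) L" "\<And>q. q \<notin> L \<Longrightarrow> \<phi> q = 0"
proof -
  obtain i where "i \<in> charts_at M p" using charts_at_nonempty[OF M p] by blast
  then have i: "i \<in> idx M" "p \<in> cdom M i" by (auto simp: charts_at_def)
  let ?c = "chart M i" and ?S = "chart M i ` cdom M i"
  define x0 where "x0 = ?c p"
  have "open ?S" "x0 \<in> ?S"
    using open_chart_range[OF M i(1)] i(2) by (auto simp: x0_def)
  \<comment> \<open>A closed ball inside the chart image makes its preimage \<open>L\<close>
    compact; below, \<open>r / 2\<close> stands for any smaller radius.\<close>
  then obtain r where r: "r > 0" "cball x0 r \<subseteq> ?S"
    using open_contains_cball by blast
  obtain h :: "real \<Rightarrow> real"
    where h: "smooth_on UNIV h" "\<And>t. t \<le> (r / 2)\<^sup>2 \<Longrightarrow> h t = 1" "\<And>t. t \<ge> r\<^sup>2 \<Longrightarrow> h t = 0"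
    using smooth_cutoff_real[of "(r / 2)\<^sup>2" "r\<^sup>2"] r(1)
    by (auto simp: power_divide)
  let ?g = "\<lambda>y. inner (y - x0) (y - x0)"
  have g: "?g y = (dist x0 y)\<^sup>2" for y
    by (metis dist_commute dist_norm power2_norm_eq_inner)
  define \<phi> where "\<phi> q = (if q \<in> cdom M i then h (?g (?c q)) else 0)" for q
  define L where "L = {q \<in> cdom M i. ?c q \<in> cball x0 r}"
  define W where "W = {q \<in> cdom M i. ?c q \<in> ball x0 (r / 2)}"
  have sub: "topspace (subtopology (mtop M) (cdom M i)) = cdom M i"
    using cdom_subset_topspace[OF M i(1)] by auto
  have imL: "?c ` L = cball x0 r" using r by (auto simp: L_def)
  have imW: "?c ` W = ball x0 (r / 2)"
  proof -
    have "ball x0 (r / 2) \<subseteq> ?S" using r by (auto simp: subset_iff)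
    then show ?thesis by (auto simp: W_def)
  qed
  have "compactin (top_of_set ?S) (?c ` L)"
    unfolding imL using r by (simp add: compactin_subtopology)
  then have "compactin (subtopology (mtop M) (cdom M i)) L"
    using homeomorphic_map_compactness[OF chart_homeomorphic[OF M i(1)], of L] sub
    by (auto simp: L_def)
  then have L: "compactin (mtop M) L" by (simp add: compactin_subtopology)
  have "openin (top_of_set ?S) (?c ` W)"
    unfolding imW by (rule open_openin_trans[OF \<open>open ?S\<close>]) (use imW in \<open>auto simp: W_def\<close>)
  then have "openin (subtopology (mtop M) (cdom M i)) W"
    using homeomorphic_map_openness[OF chart_homeomorphic[OF M i(1)], of W] sub
    by (auto simp: W_def)
  then have W: "openin (mtop M) W"
    using openin_trans_full openin_cdom[OF M i(1)] by blast
  have \<phi>0: "\<phi> q = 0" if "q \<notin> L" for q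
    using that r(1) by (auto simp: \<phi>_def L_def g intro!: h(3) power_mono)
  have \<phi>1: "\<phi> q = 1" if "q \<in> W" for q
    using that by (auto simp: \<phi>_def W_def g intro!: h(2) power_mono)
  have "smooth_on (chart M j ` cdom M j) (\<phi> \<circ> chart_inv M j)" if j: "j \<in> idx M" for j
  proof (rule smooth_on_local)
    fix x assume "x \<in> chart M j ` cdom M j"
    then obtain q where q: "q \<in> cdom M j" "x = chart M j q" by blast
    show "\<exists>T. open T \<and> x \<in> T \<and> smooth_on T (\<phi> \<circ> chart_inv M j)"
    proof (cases "q \<in> cdom M i")
      case True
      let ?T = "chart M j ` (cdom M j \<inter> cdom M i)"
      have T: "open ?T" by (rule open_chart_image[OF M j openin_cdom[OF M i(1)]])
      have "smooth_on ?T (\<lambda>y. h (?g (transition M j i y)))"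
        by (rule smooth_on_compose_real[OF T _ h(1)])
          (intro smooth_on_inner smooth_on_diff smooth_on_const smooth_on_transition[OF M] T i j, simp)
      then have "smooth_on ?T (\<phi> \<circ> chart_inv M j)"
        by (subst smooth_on_cong[OF T, of _ "\<lambda>y. h (?g (transition M j i y))"])
          (auto simp: \<phi>_def chart_inv_chart[OF M j] transition_chart[OF M j])
      then show ?thesis using T q True by blast
    next
      case False
      let ?V = "topspace (mtop M) - L"
      let ?T = "chart M j ` (cdom M j \<inter> ?V)"
      have "closedin (mtop M) L"
        using M L compactin_imp_closedin unfolding smooth_manifold_def by blast
      then have T: "open ?T"
        by (intro open_chart_image[OF M j] openin_diff openin_topspace)
      have "smooth_on ?T (\<lambda>_. 0 :: real)" by (rule smooth_on_const)
      then have "smooth_on ?T (\<phi> \<circ> chart_inv M j)"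
        by (subst smooth_on_cong[OF T, of _ "\<lambda>_. 0"]) (auto simp: chart_inv_chart[OF M j] \<phi>0)
      moreover have "x \<in> ?T"
        using q False cdom_subset_topspace[OF M j] by (auto simp: L_def)
      ultimately show ?thesis using T by blast
    qed
  qed
  then have "smooth_fun M \<phi>" by (simp add: smooth_fun_def)
  moreover have "p \<in> W" using i r by (simp add: W_def x0_def)
  ultimately show thesis using that[OF _ W _ \<phi>1 L \<phi>0] by simp
qed

text \<open>Finitely many local bump functions are combined into
  \<open>1 - \<Prod>(1 - b p)\<close>: this is 1 as soon as one factor vanishes and 0 where all
  \<open>b p\<close> vanish. Unlike a sum, it needs no rescaling where several of them
  overlap.\<close>

lemma bump_function:
  assumes K: "compactin (mtop M) K"
  obtains \<phi> W L where "smooth_fun M \<phi>" "openin (mtop M) W" "K \<subseteq> W" "\<And>q. q \<in> W \<Longrightarrow> \<phi> q = 1"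
    "compactin (mtop M) L" "\<And>q. q \<notin> L \<Longrightarrow> \<phi> q = 0"
proof -
  define bump where "bump p \<phi> W L \<longleftrightarrow> smooth_fun M \<phi> \<and> openin (mtop M) W \<and> p \<in> W \<and> (\<forall>q\<in>W. \<phi> q = 1) \<and>
    compactin (mtop M) L \<and> (\<forall>q. q \<notin> L \<longrightarrow> \<phi> q = (0::real))" for p \<phi> W L
  have "\<exists>\<phi> W L. bump p \<phi> W L" if "p \<in> K" for p
  proof -
    have "p \<in> topspace (mtop M)" using that compactin_subset_topspace[OF K] by blast
    from bump_function_at_point[OF this] show ?thesis unfolding bump_def by (smt (verit))
  qed
  then obtain b W L where bump: "\<And>p. p \<in> K \<Longrightarrow> bump p (b p) (W p) (L p)" by metis
  note b = bump[unfolded bump_def]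
  have "\<exists>\<F>. finite \<F> \<and> \<F> \<subseteq> W ` K \<and> K \<subseteq> \<Union>\<F>"
    using K b unfolding compactin_def by (auto dest!: spec[of _ "W ` K"])
  then obtain F where F: "finite F" "F \<subseteq> K" "K \<subseteq> \<Union>(W ` F)"
    by (metis finite_subset_image)
  show thesis
  proof
    show "smooth_fun M (\<lambda>q. 1 - (\<Prod>p\<in>F. 1 - b p q))"
      using b F(2) by (intro smooth_fun_diff smooth_fun_const smooth_fun_prod) auto
    show "openin (mtop M) (\<Union>(W ` F))" "K \<subseteq> \<Union>(W ` F)"
      using b F by blast+
    show "1 - (\<Prod>p\<in>F. 1 - b p q) = 1" if q: "q \<in> \<Union>(W ` F)" for q
    proof -
      obtain p where p: "p \<in> F" "q \<in> W p" using q by blast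
      with b F(2) have "1 - b p q = 0" by auto
      with p have "(\<Prod>p\<in>F. 1 - b p q) = 0" by (intro prod_zero[OF F(1)]) blast
      then show ?thesis by simp
    qed
    show "compactin (mtop M) (\<Union>(L ` F))"
      using b F by (intro compactin_Union) auto
    show "1 - (\<Prod>p\<in>F. 1 - b p q) = 0" if "q \<notin> \<Union>(L ` F)" for q
      using that b F(2) by (auto intro!: prod.neutral)
  qed
qed

section \<open>Compactly supported representatives\<close>

lemma closedin_compactin: "compactin (mtop M) K \<Longrightarrow> closedin (mtop M) K"
  using M compactin_imp_closedin unfolding smooth_manifold_def by blast

lemma compactly_supported_representative:
  assumes \<alpha>: "\<alpha> \<in> closed_forms_exact_at_infinity k M"
  obtains \<omega> L where "\<omega> \<in> closed_forms k M" "\<alpha> - \<omega> \<in> exact_forms k M"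
    "compactin (mtop M) L" "\<And>p. p \<notin> L \<Longrightarrow> \<omega> p = 0"
proof -
  let ?T = "topspace (mtop M)"
  obtain K where K: "compactin (mtop M) K" and
    ex: "\<exists>\<nu>\<in>forms_pred k (open_submanifold M (?T - K)).
      ext_deriv (open_submanifold M (?T - K)) \<nu> =
        restrict_form \<alpha> (topspace (mtop (open_submanifold M (?T - K))))"
    using \<alpha> unfolding closed_forms_exact_at_infinity_def Let_def by (elim CollectE conjE exE)
  have \<alpha>_closed: "\<alpha> \<in> closed_forms k M"
    using \<alpha> unfolding closed_forms_exact_at_infinity_def by blast
  then have \<alpha>_form: "\<alpha> \<in> forms k M" by (simp add: closed_forms_def)
  define V where "V = ?T - K"
  define N where "N = open_submanifold M V"
  have V: "openin (mtop M) V"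
    unfolding V_def by (intro openin_diff openin_topspace closedin_compactin K)
  have N: "smooth_manifold N"
    unfolding N_def by (rule smooth_manifold_submanifold[OF M V])
  have topN: "topspace (mtop N) = V"
    unfolding N_def by (rule topspace_submanifold[OF M V])
  obtain \<nu> where \<nu>: "\<nu> \<in> forms_pred k N" "ext_deriv N \<nu> = restrict_form \<alpha> V"
    using ex unfolding V_def[symmetric] N_def[symmetric] topN by blast
  show thesis
  proof (cases k)
    \<comment> \<open>There are no nonzero forms of degree -1, so \<open>\<nu> = 0\<close> and
      \<open>\<alpha>\<close> itself vanishes outside \<open>K\<close>; it is its own
      representative.\<close>
    case 0
    then have "restrict_form \<alpha> V = 0"
      using \<nu> ext_deriv_zero[OF N] by (simp add: forms_pred_def)
    have "\<alpha> p = 0" if "p \<notin> K" for p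
      using that formsD(2)[OF \<alpha>_form, of p] \<open>restrict_form \<alpha> V = 0\<close>[THEN fun_cong, of p]
      by (cases "p \<in> ?T") (auto simp: V_def restrict_form_def)
    moreover have "\<alpha> - \<alpha> \<in> exact_forms k M"
      using subspace_0[OF subspace_exact_forms[OF M]] by simp
    ultimately show thesis using that[of \<alpha> K] \<alpha>_closed K by blast
  next
    case (Suc m)
    have \<nu>_form: "\<nu> \<in> forms m N" using \<nu>(1) Suc by (simp add: forms_pred_def)
    have \<nu>_outside: "\<nu> p = 0" if "p \<notin> V" for p
      using formsD(2)[OF \<nu>_form] that topN by simp
    obtain \<phi> W L where \<phi>: "smooth_fun M \<phi>" and W: "openin (mtop M) W" "K \<subseteq> W" "\<And>q. q \<in> W \<Longrightarrow> \<phi> q = 1"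
      and L: "compactin (mtop M) L" "\<And>q. q \<notin> L \<Longrightarrow> \<phi> q = 0"
      using bump_function[OF K] by blast
    have \<phi>N: "smooth_fun N \<phi>" "smooth_fun N (\<lambda>p. 1 - \<phi> p)"
      unfolding N_def
      by (intro smooth_fun_submanifold[OF V] smooth_fun_diff smooth_fun_const \<phi>)+
    \<comment> \<open>The factor \<open>1 - \<phi>\<close> vanishes on \<open>W\<close>, in
      particular around \<open>K\<close>, where \<open>\<nu>\<close> has only its default value 0.
      Being zero on \<open>W\<close> and smooth on \<open>V\<close>, \<open>\<mu>\<close> is a form
      on all of \<open>M\<close>, so that \<open>d\<mu>\<close> is exact there.\<close>
    define \<mu> where "\<mu> = scale_form (\<lambda>p. 1 - \<phi> p) \<nu>"
    have \<mu>W: "restrict_form \<mu> W = 0"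
      using W(3) by (auto simp: \<mu>_def restrict_form_def scale_form_def fun_eq_iff scaleR_fun_def)
    have \<mu>V: "restrict_form \<mu> V = \<mu>"
      using \<nu>_outside by (auto simp: \<mu>_def restrict_form_def scale_form_def fun_eq_iff scaleR_fun_def)
    have \<mu>N: "\<mu> \<in> forms m N"
      unfolding \<mu>_def by (rule scale_form_mem_forms[OF N \<phi>N(2) \<nu>_form])
    have cover: "p \<in> W \<or> p \<in> V" if "p \<in> ?T" for p
      using that W(2) by (auto simp: V_def)
    have WM: "smooth_manifold (open_submanifold M W)"
      by (rule smooth_manifold_submanifold[OF M W(1)])
    have \<mu>: "\<mu> \<in> forms m M"
    proof (rule forms_local[OF M])
      fix p assume "p \<in> ?T"
      then show "\<exists>V. openin (mtop M) V \<and> p \<in> V \<and> restrict_form \<mu> V \<in> forms m (open_submanifold M V)"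
        using cover \<mu>W \<mu>V \<mu>N W(1) V subspace_0[OF subspace_forms[OF WM]] unfolding N_def by metis
    qed (use \<nu>_outside in \<open>auto simp: V_def \<mu>_def scale_form_def\<close>)
    define \<omega> where "\<omega> = \<alpha> - ext_deriv M \<mu>"
    have res: "restrict_form \<omega> X = restrict_form \<alpha> X - ext_deriv (open_submanifold M X) (restrict_form \<mu> X)"
      if "openin (mtop M) X" for X
      unfolding \<omega>_def restrict_ext_deriv[OF M that, symmetric]
      by (rule linear_diff[OF linear_restrict_form])
    have \<omega>W: "restrict_form \<omega> W \<in> closed_forms k (open_submanifold M W)"
      using res[OF W(1)] \<mu>W ext_deriv_zero[OF WM] restrict_form_mem_closed_forms[OF M W(1) \<alpha>_closed]
      by simp
    have \<omega>V: "restrict_form \<omega> V = ext_deriv N (scale_form \<phi> \<nu>)"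
    proof -
      have "\<nu> = scale_form \<phi> \<nu> + \<mu>"
        by (simp add: \<mu>_def scale_form_def scaleR_fun_def fun_eq_iff algebra_simps)
      then have "ext_deriv N \<nu> = ext_deriv N (scale_form \<phi> \<nu>) + ext_deriv N \<mu>"
        using ext_deriv_add[OF N scale_form_mem_forms[OF N \<phi>N(1) \<nu>_form] \<mu>N] by simp
      then show ?thesis
        using res[OF V] by (simp add: \<mu>V \<nu>(2) flip: N_def)
    qed
    have "ext_deriv N \<nu> \<in> closed_forms (Suc m) N"
      unfolding \<nu>(2)
      using restrict_form_mem_closed_forms[OF M V \<alpha>_closed, folded N_def] Suc by simp
    then have \<omega>V': "restrict_form \<omega> V \<in> closed_forms k N"
      unfolding \<omega>V Suc by (rule ext_deriv_scale_form_closed[OF N \<phi>N(1) \<nu>_form])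
    have \<omega>_outside: "\<omega> p = 0" if "p \<notin> ?T" for p
      using that formsD(2)[OF \<alpha>_form] by (simp add: \<omega>_def ext_deriv_def fun_eq_iff)
    have "\<omega> \<in> closed_forms k M"
    proof (rule closed_forms_local[OF M])
      fix p assume "p \<in> ?T"
      then show "\<exists>V. openin (mtop M) V \<and> p \<in> V \<and> restrict_form \<omega> V \<in> closed_forms k (open_submanifold M V)"
        using cover \<omega>W \<omega>V' W(1) V unfolding N_def by metis
    qed (rule \<omega>_outside)
    moreover have "\<alpha> - \<omega> \<in> exact_forms k M"
      using \<mu> Suc by (simp add: \<omega>_def exact_forms_def forms_pred_def)
    moreover have "\<omega> p = 0" if p: "p \<notin> L" for p
    proof (cases "p \<in> ?T")
      case True
      let ?X = "?T - L"
      have "openin (mtop M) ?X"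
        by (intro openin_diff openin_topspace closedin_compactin L)
      \<comment> \<open>\<open>\<phi>\<close> is 1 on \<open>K\<close> and 0 off \<open>L\<close>,
        so \<open>K\<close> lies in \<open>L\<close>.\<close>
      moreover have "?X \<subseteq> V"
        using W(2,3) L(2) by (force simp: V_def)
      ultimately have X: "openin (mtop N) ?X"
        by (auto simp: N_def open_submanifold_def openin_subtopology)
      have "restrict_form (scale_form \<phi> \<nu>) ?X = 0"
        using L(2) by (auto simp: restrict_form_def scale_form_def fun_eq_iff scaleR_fun_def)
      then have "restrict_form (restrict_form \<omega> V) ?X = 0"
        unfolding \<omega>V restrict_ext_deriv[OF N X]
        using ext_deriv_zero[OF smooth_manifold_submanifold[OF N X]] by simp
      then have "restrict_form (restrict_form \<omega> V) ?X p = 0" by simp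
      then show ?thesis using True p \<open>?X \<subseteq> V\<close> by (auto simp: restrict_form_def split: if_splits)
    qed (rule \<omega>_outside)
    ultimately show thesis using that[of \<omega> L] L(1) by blast
  qed
qed

text \<open>As \<open>L\<close> is compact in a Hausdorff space, its complement is open and covers
  the manifold together with \<open>U\<close>; on that complement \<open>\<omega>\<close> is zero.
  There the zero form also serves as primitive, with \<open>L\<close> as the compact set to be
  removed.\<close>

lemma extend_compactly_supported:
  assumes U: "openin (mtop M) U" and \<omega>: "\<omega> \<in> closed_forms k (open_submanifold M U)"
    and L: "compactin (mtop M) L" "L \<subseteq> U" "\<And>p. p \<notin> L \<Longrightarrow> \<omega> p = 0"
  shows "\<omega> \<in> closed_forms_exact_at_infinity k M"
proof -
  let ?V = "topspace (mtop M) - L"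
  have V: "openin (mtop M) ?V"
    by (intro openin_diff openin_topspace closedin_compactin L)
  have N: "smooth_manifold (open_submanifold M ?V)"
    by (rule smooth_manifold_submanifold[OF M V])
  have V0: "restrict_form \<omega> ?V = 0" using L(3) by (auto simp: restrict_form_def fun_eq_iff)
  have "\<omega> \<in> closed_forms k M"
  proof (rule closed_forms_local[OF M])
    fix p assume p: "p \<in> topspace (mtop M)"
    show "\<exists>V. openin (mtop M) V \<and> p \<in> V \<and> restrict_form \<omega> V \<in> closed_forms k (open_submanifold M V)"
    proof (cases "p \<in> L")
      case True
      have "restrict_form \<omega> U = \<omega>" using L by (auto simp: restrict_form_def fun_eq_iff)
      then show ?thesis using True L(2) U \<omega> by (intro exI[of _ U]) auto
    next
      case False
      then show ?thesis
        using p V zero_mem_closed_forms[OF N] by (intro exI[of _ ?V]) (simp add: V0)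
    qed
  qed (use L compactin_subset_topspace in blast)
  moreover have "\<exists>\<nu>\<in>forms_pred k (open_submanifold M ?V).
      ext_deriv (open_submanifold M ?V) \<nu> =
        restrict_form \<omega> (topspace (mtop (open_submanifold M ?V)))"
    using subspace_0[OF subspace_forms_pred[OF N]] ext_deriv_zero[OF N] V0
    unfolding topspace_submanifold[OF M V] by metis
  ultimately show ?thesis
    using L(1) unfolding closed_forms_exact_at_infinity_def Let_def by blast
qed

end

theorem proposition3p2:
  fixes M :: "('i, 'a, 'e::{real_inner,heine_borel}) manifold"
    and U :: "'a set"
    and k :: nat
  assumes "smooth_manifold M"
    and "openin (mtop M) U"
  shows "c_number k (open_submanifold M U) \<le> c_number k M"
  unfolding c_number_def
proof (rule quotient_dim_le[where R = "\<lambda>\<omega>. restrict_form \<omega> U"])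
  let ?N = "open_submanifold M U"
  have N: "smooth_manifold ?N"
    using assms by (rule smooth_manifold_submanifold)
  show "subspace (exact_forms k ?N)" "subspace (exact_forms k M)"
    by (rule subspace_exact_forms[OF N], rule subspace_exact_forms[OF assms(1)])
  show "linear (\<lambda>\<omega>. restrict_form \<omega> U)" by (rule linear_restrict_form)
  show "(\<lambda>\<omega>. restrict_form \<omega> U) ` exact_forms k M \<subseteq> exact_forms k ?N"
    using restrict_form_mem_exact_forms[OF assms] by blast
  fix \<alpha> assume "\<alpha> \<in> closed_forms_exact_at_infinity k ?N"
  then obtain \<omega> L where \<omega>: "\<omega> \<in> closed_forms k ?N" "\<alpha> - \<omega> \<in> exact_forms k ?N"
    "compactin (mtop ?N) L" "\<And>p. p \<notin> L \<Longrightarrow> \<omega> p = 0"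
    using compactly_supported_representative[OF N] by metis
  \<comment> \<open>Compactness in the subspace \<open>U\<close> passes to \<open>M\<close>. This
    controls the boundary of \<open>U\<close>, across which a general form on \<open>U\<close> need
    not extend.\<close>
  have L: "compactin (mtop M) L" "L \<subseteq> U"
    using \<omega>(3) by (simp_all add: open_submanifold_def compactin_subtopology)
  have "\<omega> \<in> closed_forms_exact_at_infinity k M"
    by (rule extend_compactly_supported[OF assms \<omega>(1) L \<omega>(4)])
  moreover have "restrict_form \<omega> U = \<omega>"
    using \<omega>(4) L(2) by (auto simp: restrict_form_def fun_eq_iff)
  ultimately show "\<exists>e\<in>closed_forms_exact_at_infinity k M. \<alpha> - restrict_form e U \<in> exact_forms k ?N"
    using \<omega>(2) by (intro bexI[of _ \<omega>]) simp_all
qed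

end
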